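(* Let $k$ be an algebraically closed field, let $\Lambda=kQ$ be the four subspace algebra, and let $M=(A,B,C,D)$ be a $\Lambda$-module with $A\in\mathbb M_{n_0\times n_1}$, $B\in\mathbb M_{n_0\times n_2}$, $C\in\mathbb M_{n_0\times n_3}$, $D\in\mathbb M_{n_0\times n_4}$ ($n_0,\dots,n_4\ge 0$). For the indecomposable $\Lambda$-modules $X$ in the list below, the dimension $[M,X]=\dim_k\operatorname{Hom}_\Lambda(M,X)$ is given by the following formulas (with $\mathcal M_1,\mathcal M_2,\mathcal M_3$ the block matrices and $\operatorname{cor}$ the corank defined in the context). **Postprojective modules.** (1) $[M,P(0,0)]=\operatorname{cor}([A\ B\ C\ D])$. (2) For $n\ge 1$: $[M,P(n,0)]=\operatorname{cor}(\mathcal M_3(Z,Z',C\oplus D,n-1))$ with $Z'=\begin{bmatrix}A&0&B&0&C&D\\0&0&0&B&0&-D\\0&A&0&0&-C&0\end{bmatrix}$, $Z=\begin{bmatrix}0&-D&0&B\\-C&0&A&0\end{bmatrix}$. (3) For $n\ge 0$: - $[M,P(2n+1,1)]=\operatorname{cor}(\mathcal M_3(Z,Z,-A,n))$, $Z=\begin{bmatrix}A&0&C&D\\0&B&0&-D\end{bmatrix}$; - $[M,P(2n+1,2)]=\operatorname{cor}(\mathcal M_3(Z,Z,-B,n))$, $Z=\begin{bmatrix}B&0&D&A\\0&C&0&-A\end{bmatrix}$; - $[M,P(2n+1,3)]=\operatorname{cor}(\mathcal M_3(Z,Z,-C,n))$, $Z=\begin{bmatrix}C&0&A&B\\0&D&0&-B\end{bmatrix}$;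 - $[M,P(2n+1,4)]=\operatorname{cor}(\mathcal M_3(Z,Z,-D,n))$, $Z=\begin{bmatrix}D&0&B&C\\0&A&0&-C\end{bmatrix}$. (4) For $n\ge 0$: - $[M,P(2n,1)]=\operatorname{cor}(\mathcal M_1(Z,Z',-D,n))$, $Z'=[B\ C\ D]$, $Z=\begin{bmatrix}C&A&0&0\\-C&0&B&D\end{bmatrix}$; - $[M,P(2n,2)]=\operatorname{cor}(\mathcal M_1(Z,Z',-A,n))$, $Z'=[C\ D\ A]$, $Z=\begin{bmatrix}D&B&0&0\\-D&0&C&A\end{bmatrix}$; - $[M,P(2n,3)]=\operatorname{cor}(\mathcal M_1(Z,Z',-B,n))$, $Z'=[D\ A\ B]$, $Z=\begin{bmatrix}A&C&0&0\\-A&0&D&B\end{bmatrix}$; - $[M,P(2n,4)]=\operatorname{cor}(\mathcal M_1(Z,Z',-C,n))$, $Z'=[A\ B\ C]$, $Z=\begin{bmatrix}B&D&0&0\\-B&0&A&C\end{bmatrix}$. **Preinjective modules.** (5) $[M,I(0,0)]=n_0$; for $n\ge 1$: $[M,I(n,0)]=\operatorname{cor}(\mathcal M_2(Z,Z',D\oplus C,n-1))$ with $Z'=\begin{bmatrix}D&C&0&0\\0&-C&0&B\\-D&0&A&0\end{bmatrix}$, $Z=\begin{bmatrix}0&-C&0&B\\-D&0&A&0\end{bmatrix}$. (6) For $n\ge 0$: - $[M,I(2n+1,1)]=\operatorname{cor}(\mathcal M_2(Z,A,-C,n))$, $Z=\begin{bmatrix}C&D&0&B\\0&-D&A&0\end{bmatrix}$;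 - $[M,I(2n+1,2)]=\operatorname{cor}(\mathcal M_2(Z,B,-D,n))$, $Z=\begin{bmatrix}D&A&0&C\\0&-A&B&0\end{bmatrix}$; - $[M,I(2n+1,3)]=\operatorname{cor}(\mathcal M_2(Z,C,-A,n))$, $Z=\begin{bmatrix}A&B&0&D\\0&-B&C&0\end{bmatrix}$; - $[M,I(2n+1,4)]=\operatorname{cor}(\mathcal M_2(Z,D,-B,n))$, $Z=\begin{bmatrix}B&C&0&A\\0&-C&D&0\end{bmatrix}$. (7) $[M,I(0,j)]=n_j$ for $j=1,2,3,4$; and for $n\ge 1$: - $[M,I(2n,1)]=\operatorname{cor}(\mathcal M_2(Z,Z',-A,n-1))$, $Z'=\begin{bmatrix}B&0&D\\0&C&-D\end{bmatrix}$, $Z=\begin{bmatrix}A&B&0&D\\0&0&C&-D\end{bmatrix}$; - $[M,I(2n,2)]=\operatorname{cor}(\mathcal M_2(Z,Z',-B,n-1))$, $Z'=\begin{bmatrix}C&0&A\\0&D&-A\end{bmatrix}$, $Z=\begin{bmatrix}B&C&0&A\\0&0&D&-A\end{bmatrix}$; - $[M,I(2n,3)]=\operatorname{cor}(\mathcal M_2(Z,Z',-C,n-1))$, $Z'=\begin{bmatrix}D&0&B\\0&A&-B\end{bmatrix}$, $Z=\begin{bmatrix}C&D&0&B\\0&0&A&-B\end{bmatrix}$; - $[M,I(2n,4)]=\operatorname{cor}(\mathcal M_2(Z,Z',-D,n-1))$, $Z'=\begin{bmatrix}A&0&C\\0&B&-C\end{bmatrix}$, $Z=\begin{bmatrix}D&A&0&C\\0&0&B&-C\end{bmatrix}$.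 **Regular modules** (in all formulas $l\ge 1$). (8) For $\lambda\in k\setminus\{0,1\}$: $[M,R(l,\lambda)]=\operatorname{cor}(\mathcal M_2(Z,Z,-D,l-1))$, $Z=\begin{bmatrix}D&C&B&0\\-\lambda D&-C&0&A\end{bmatrix}$. (9) Even quasi-length: - $[M,R(0,2l,0)]=\operatorname{cor}(\mathcal M_2(Z,Z,-D,l-1))$, $Z=\begin{bmatrix}D&C&B&0\\0&-C&0&A\end{bmatrix}$; - $[M,R(1,2l,0)]=\operatorname{cor}(\mathcal M_2(Z,Z,-C,l-1))$, $Z=\begin{bmatrix}C&D&A&0\\0&-D&0&B\end{bmatrix}$; - $[M,R(0,2l,1)]=\operatorname{cor}(\mathcal M_2(Z,Z,-B,l-1))$, $Z=\begin{bmatrix}B&D&A&0\\0&-D&0&C\end{bmatrix}$; - $[M,R(1,2l,1)]=\operatorname{cor}(\mathcal M_2(Z,Z,-D,l-1))$, $Z=\begin{bmatrix}D&B&C&0\\0&-B&0&A\end{bmatrix}$; - $[M,R(0,2l,\infty)]=\operatorname{cor}(\mathcal M_2(Z,Z,-D,l-1))$, $Z=\begin{bmatrix}D&C&A&0\\0&-C&0&B\end{bmatrix}$; - $[M,R(1,2l,\infty)]=\operatorname{cor}(\mathcal M_2(Z,Z,-C,l-1))$, $Z=\begin{bmatrix}C&D&B&0\\0&-D&0&A\end{bmatrix}$. (10) Odd quasi-length: - $[M,R(0,2l-1,0)]=\operatorname{cor}(\mathcal M_2(Z,Z',-B,l-1))$, $Z'=[A\ C]$, $Z=\begin{bmatrix}B&D&0&A\\0&0&C&-A\end{bmatrix}$;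 - $[M,R(1,2l-1,0)]=\operatorname{cor}(\mathcal M_2(Z,Z',-A,l-1))$, $Z'=[B\ D]$, $Z=\begin{bmatrix}A&C&0&B\\0&0&D&-B\end{bmatrix}$; - $[M,R(0,2l-1,1)]=\operatorname{cor}(\mathcal M_2(Z,Z',-A,l-1))$, $Z'=[C\ D]$, $Z=\begin{bmatrix}A&B&0&C\\0&0&D&-C\end{bmatrix}$; - $[M,R(1,2l-1,1)]=\operatorname{cor}(\mathcal M_2(Z,Z',-C,l-1))$, $Z'=[A\ B]$, $Z=\begin{bmatrix}C&D&0&A\\0&0&B&-A\end{bmatrix}$; - $[M,R(0,2l-1,\infty)]=\operatorname{cor}(\mathcal M_2(Z,Z',-A,l-1))$, $Z'=[B\ C]$, $Z=\begin{bmatrix}A&D&0&B\\0&0&C&-B\end{bmatrix}$; - $[M,R(1,2l-1,\infty)]=\operatorname{cor}(\mathcal M_2(Z,Z',-B,l-1))$, $Z'=[A\ D]$, $Z=\begin{bmatrix}B&C&0&A\\0&0&D&-A\end{bmatrix}$.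
   Context: **Basic notation.** $k$ is an algebraically closed field and $\mathbb M_{n\times m}$ is the set of $n\times m$ matrices over $k$, $n,m\ge 0$ (matrices with zero rows or zero columns are allowed). For $A\in\mathbb M_{m\times n}$, $\operatorname{r}(A)$ is its rank and $\operatorname{cor}(A)=m-\operatorname{r}(A)$ its corank (number of rows minus rank). $A\oplus B=\begin{bmatrix}A&0\\0&B\end{bmatrix}$. **Algebra and modules.** $Q$ is the quiver with vertices $0,1,2,3,4$ and exactly four arrows, one arrow $i\to 0$ for each $i=1,2,3,4$; $\Lambda=kQ$ is the four subspace algebra. A quadruple $(A,B,C,D)\in\mathbb M_{n_0\times n_1}\times\mathbb M_{n_0\times n_2}\times\mathbb M_{n_0\times n_3}\times\mathbb M_{n_0\times n_4}$ denotes the $\Lambda$-module (representation of $Q$) with spaces $k^{n_0},\dots,k^{n_4}$ at the vertices $0,\dots,4$ and with left multiplications by $A,B,C,D$ as the maps $k^{n_i}\to k^{n_0}$, $i=1,2,3,4$ respectively. A homomorphism from $(A,B,C,D)$ to $(A',B',C',D')$ (the latter of dimension vector $[m_0,\dots,m_4]$) is a collection $(F_0,\dots,F_4)$, $F_i\in\mathbb M_{m_i\times n_i}$, with $F_0A=A'F_1$, $F_0B=B'F_2$, $F_0C=C'F_3$, $F_0D=D'F_4$. $[M,X]:=\dim_k\operatorname{Hom}_\Lambda(M,X)$. **Block matrices.** Let $x,y,x',y',u,v,s,t,i\ge 0$ be integers with $u\le x$, $v\le y$, $v\le y'$, $s\le x$, $s\le x'$, $t\le y$, and let $Z\in\mathbb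 M_{x\times y}$, $Z'\in\mathbb M_{x'\times y'}$, $F\in\mathbb M_{u\times v}$, $E\in\mathbb M_{s\times t}$. Let $F'\in\mathbb M_{x\times y}$ and $F''\in\mathbb M_{x\times y'}$ be the matrices having $F$ as the upper right corner block and zeros elsewhere; let $E'\in\mathbb M_{x\times y}$ and $E''\in\mathbb M_{x'\times y}$ be the matrices having $E$ as the lower left corner block and zeros elsewhere. Define the following block matrices (unspecified blocks are zero; $Z',E'',F''$ occur only once): - $\mathcal M_1(Z,Z',F,i)\in\mathbb M_{(x'+ix)\times(y'+iy)}$: block lower bidiagonal, with diagonal blocks $Z',Z,\dots,Z$ ($i$ copies of $Z$) and subdiagonal blocks (directly below the diagonal) $F'',F',\dots,F'$ ($i$ blocks in total, the first being $F''$); - $\mathcal M_2(Z,Z',E,i)\in\mathbb M_{(x'+ix)\times(y'+iy)}$: block upper bidiagonal, with diagonal blocks $Z',Z,\dots,Z$ ($i$ copies of $Z$) and superdiagonal blocks $E'',E',\dots,E'$ ($i$ blocks in total, the first being $E''$); - $\mathcal M_3(Z,Z',E,i)\in\mathbb M_{(x'+ix)\times(y'+(i+1)y)}$: $i+1$ block rows and $i+2$ block columns, with diagonal blocks $Z',Z,\dots,Z$ ($i$ copies of $Z$) and superdiagonal blocks $E'',E',\dots,E'$ ($i+1$ blocks in total, the first being $E''$), so the last block row is $[0\ \cdots\ 0\ Z\ E']$ if $i\ge1$. In particular $\mathcal M_1(Z,Z',F,0)=\mathcal M_2(Z,Z',E,0)=Z'$ and $\mathcal M_3(Z,Z',E,0)=[Z'\,|\,E'']$.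 **Indecomposable modules.** $\tau$ is the Auslander–Reiten translate of $\operatorname{mod}\Lambda$; $P(m,j)=\tau^{-m}P(j)$ and $I(m,j)=\tau^mI(j)$, where $P(j)$, $I(j)$ are the indecomposable projective and injective modules at vertex $j$. The regular indecomposables lie in tubes $\mathcal T_\lambda$, $\lambda\in\mathbb P^1(k)$, where $\mathcal T_0,\mathcal T_1,\mathcal T_\infty$ have rank 2 and the others are homogeneous: $R(s,l,\lambda)$, $s\in\mathbb Z_2$, $\lambda\in\{0,1,\infty\}$, has quasi-length $l$ and quasi-socle $R(s,1,\lambda)$; $R(l,\lambda)$, $\lambda\in k\setminus\{0,1\}$, has quasi-length $l$. The modules are fixed by the following explicit matrix representatives. Here $[X;Y;\dots]$ denotes vertical stacking of blocks, $I_n$ (with a single subscript) is the identity matrix, $0_{m,n}$ and $0_n=0_{n,n}$ are zero matrices, ${}^\circ\pi_n=[I_n\,|\,0]\in\mathbb M_{n\times(n+1)}$ (last column zero), $\pi^\circ_n=[0\,|\,I_n]\in\mathbb M_{n\times(n+1)}$ (first column zero), $\overline I_n$ is the $n\times n$ antidiagonal permutation matrix, and $J_l(\lambda)$ is the upper triangular $l\times l$ Jordan block with eigenvalue $\lambda$. For $n\ge 0$: - $P(n,0)=([I_n;0_{n+1,n}],\,[0_{n+1,n};I_n],\,[0_{1,n};I_n;\overline I_n],\,[I_n;\overline I_n;0_{1,n}])$. - With $a=[0_{1,n};I_n;I_n;0_{1,n}]$, $b=[I_{n+1};0_{n+1}]$, $c=[0_{n+1};I_{n+1}]$, $d=[I_{n+1};I_{n+1}]$: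 $P(2n+1,1)=(a,b,c,d)$, $P(2n+1,2)=(d,a,b,c)$, $P(2n+1,3)=(c,d,a,b)$, $P(2n+1,4)=(b,c,d,a)$. - With $a=[I_{n+1};0_{n,n+1}]$, $b=[0_{n+1,n};I_n]$, $c=[0_{1,n};I_n;I_n]$, $d=[I_n;0_{1,n};I_n]$: $P(2n,1)=(a,b,c,d)$, $P(2n,2)=(d,a,b,c)$, $P(2n,3)=(c,d,a,b)$, $P(2n,4)=(b,c,d,a)$. - $I(n,0)=([0_{n,n+1};I_{n+1}],\,[I_{n+1};0_{n,n+1}],\,[\overline I_{n+1};{}^\circ\pi_n],\,[\pi^\circ_n;\overline I_{n+1}])$. - With $a=[0_{n+1,n};I_n]$, $b=[I_{n+1};0_{n,n+1}]$, $c=[I_{n+1};\pi^\circ_n]$, $d=[I_{n+1};{}^\circ\pi_n]$: $I(2n+1,1)=(a,b,c,d)$, $I(2n+1,2)=(d,a,b,c)$, $I(2n+1,3)=(c,d,a,b)$, $I(2n+1,4)=(b,c,d,a)$. - With $a=[{}^\circ\pi_n;\pi^\circ_n]$, $b=[0_n;I_n]$, $c=[I_n;0_n]$, $d=[I_n;I_n]$: $I(2n,1)=(a,b,c,d)$, $I(2n,2)=(d,a,b,c)$, $I(2n,3)=(c,d,a,b)$, $I(2n,4)=(b,c,d,a)$. For $l\ge 1$: - $R(l,\lambda)=([I_l;0_l],[0_l;I_l],[I_l;I_l],[J_l(\lambda);I_l])$, $\lambda\in k\setminus\{0,1\}$. - With $p=[I_l;0_l]$, $q=[0_l;I_l]$,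 $e=[I_l;I_l]$, $j=[J_l(0);I_l]$: $R(0,2l,0)=(p,q,e,j)$, $R(1,2l,0)=(q,p,j,e)$, $R(0,2l,1)=(q,j,p,e)$, $R(1,2l,1)=(p,e,q,j)$, $R(0,2l,\infty)=(q,p,e,j)$, $R(1,2l,\infty)=(p,q,j,e)$. - With $f=[I_{l-1};0_{1,l-1};I_{l-1}]$, $g=[{}^\circ\pi_{l-1};I_l]$, $p=[I_{l-1};0_{l,l-1}]$, $q=[0_{l-1,l};I_l]$: $R(0,2l-1,0)=(f,g,p,q)$, $R(1,2l-1,0)=(g,f,q,p)$, $R(0,2l-1,1)=(g,q,f,p)$, $R(1,2l-1,1)=(f,p,g,q)$, $R(0,2l-1,\infty)=(g,f,p,q)$, $R(1,2l-1,\infty)=(f,g,q,p)$. *)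

theory Defs
  imports "Jordan_Normal_Form.DL_Rank" "Jordan_Normal_Form.Jordan_Normal_Form" "HOL-Library.Z2"
begin

hide_const (open) Multiset.mult Polynomial.smult Modules.module

section \<open>Block matrices\<close>

definition append_cols :: "'a :: zero mat \<Rightarrow> 'a mat \<Rightarrow> 'a mat" where
  "append_cols A B = four_block_mat A B (0\<^sub>m 0 (dim_col A)) (0\<^sub>m 0 (dim_col B))"

fun hcat :: "'a :: zero mat list \<Rightarrow> 'a mat" where
  "hcat [] = 0\<^sub>m 0 0"
| "hcat [A] = A"
| "hcat (A # B # As) = append_cols A (hcat (B # As))"

fun vcat :: "'a :: zero mat list \<Rightarrow> 'a mat" where
  "vcat [] = 0\<^sub>m 0 0"
| "vcat [A] = A"
| "vcat (A # B # As) = A @\<^sub>r vcat (B # As)"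

text \<open>The matrix given by a list of block rows. Zero blocks are written explicitly as
  \<^term>\<open>0\<^sub>m nr nc\<close>, since even an empty block contributes to the dimensions.\<close>

definition block_mat :: "'a :: zero mat list list \<Rightarrow> 'a mat" where
  "block_mat Ass = vcat (map hcat Ass)"

definition upper_right :: "nat \<Rightarrow> nat \<Rightarrow> 'a :: zero mat \<Rightarrow> 'a mat" where
  "upper_right nr nc F =
     (let u = dim_row F; v = dim_col F in
      four_block_mat (0\<^sub>m u (nc - v)) F
                     (0\<^sub>m (nr - u) (nc - v)) (0\<^sub>m (nr - u) v))"

definition lower_left :: "nat \<Rightarrow> nat \<Rightarrow> 'a :: zero mat \<Rightarrow> 'a mat" where
  "lower_left nr nc E =
     (let s = dim_row E; t = dim_col E in
      four_block_mat (0\<^sub>m (nr - s) t) (0\<^sub>m (nr - s) (nc - t))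
                     E (0\<^sub>m s (nc - t)))"

text \<open>Block rows and block columns are numbered from 0. Block row \<open>0\<close> and block column \<open>0\<close> have
  the height and the width of \<open>Z'\<close>, all others those of \<open>Z\<close>.\<close>

definition \<M>\<^sub>1 :: "'a :: zero mat \<Rightarrow> 'a mat \<Rightarrow> 'a mat \<Rightarrow> nat \<Rightarrow> 'a mat" where
  "\<M>\<^sub>1 Z Z' F i =
     (let ht = (\<lambda>p. if p = 0 then dim_row Z' else dim_row Z);
          wd = (\<lambda>q. if q = 0 then dim_col Z' else dim_col Z)
      in block_mat (map (\<lambda>p. map (\<lambda>q.
           if p = q then (if p = 0 then Z' else Z)
           else if p = Suc q then upper_right (ht p) (wd q) F
           else 0\<^sub>m (ht p) (wd q)) [0..<i + 1]) [0..<i + 1]))"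

definition \<M>\<^sub>2 :: "'a :: zero mat \<Rightarrow> 'a mat \<Rightarrow> 'a mat \<Rightarrow> nat \<Rightarrow> 'a mat" where
  "\<M>\<^sub>2 Z Z' E i =
     (let ht = (\<lambda>p. if p = 0 then dim_row Z' else dim_row Z);
          wd = (\<lambda>q. if q = 0 then dim_col Z' else dim_col Z)
      in block_mat (map (\<lambda>p. map (\<lambda>q.
           if p = q then (if p = 0 then Z' else Z)
           else if q = Suc p then lower_left (ht p) (wd q) E
           else 0\<^sub>m (ht p) (wd q)) [0..<i + 1]) [0..<i + 1]))"

definition \<M>\<^sub>3 :: "'a :: zero mat \<Rightarrow> 'a mat \<Rightarrow> 'a mat \<Rightarrow> nat \<Rightarrow> 'a mat" where
  "\<M>\<^sub>3 Z Z' E i =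
     (let ht = (\<lambda>p. if p = 0 then dim_row Z' else dim_row Z);
          wd = (\<lambda>q. if q = 0 then dim_col Z' else dim_col Z)
      in block_mat (map (\<lambda>p. map (\<lambda>q.
           if p = q then (if p = 0 then Z' else Z)
           else if q = Suc p then lower_left (ht p) (wd q) E
           else 0\<^sub>m (ht p) (wd q)) [0..<i + 2]) [0..<i + 1]))"

definition cor :: "'a :: field mat \<Rightarrow> nat" where
  "cor A = dim_row A - vec_space.rank (dim_row A) A"


section \<open>Modules over the four subspace algebra and their homomorphism spaces\<close>

text \<open>A module is a quadruple \<open>(A, B, C, D)\<close> of matrices with the same number \<open>n\<^sub>0\<close> of rows;
  its dimension vector is read off from the dimensions of the matrices, which in
  \<^typ>\<open>'a mat\<close> are recorded also when one of them is zero.\<close>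

type_synonym 'a quad = "'a mat \<times> 'a mat \<times> 'a mat \<times> 'a mat"

text \<open>The fields \<open>mult\<close> and \<open>one\<close> are only present because the record type of modules extends
  that of rings; they play no role in the vector space structure.\<close>

fun hom_space :: "'a :: field quad \<Rightarrow> 'a quad \<Rightarrow>
    ('a, 'a mat \<times> 'a mat \<times> 'a mat \<times> 'a mat \<times> 'a mat) module" where
  "hom_space (A, B, C, D) (A', B', C', D') =
    \<lparr> carrier = {(F0, F1, F2, F3, F4).
        F0 \<in> carrier_mat (dim_row A') (dim_row A) \<and>
        F1 \<in> carrier_mat (dim_col A') (dim_col A) \<and>
        F2 \<in> carrier_mat (dim_col B') (dim_col B) \<and>
        F3 \<in> carrier_mat (dim_col C') (dim_col C) \<and>
        F4 \<in> carrier_mat (dim_col D') (dim_col D) \<and>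
        F0 * A = A' * F1 \<and> F0 * B = B' * F2 \<and> F0 * C = C' * F3 \<and> F0 * D = D' * F4},
      mult = undefined,
      one = undefined,
      zero = (0\<^sub>m (dim_row A') (dim_row A), 0\<^sub>m (dim_col A') (dim_col A),
              0\<^sub>m (dim_col B') (dim_col B), 0\<^sub>m (dim_col C') (dim_col C),
              0\<^sub>m (dim_col D') (dim_col D)),
      add = (\<lambda>(F0, F1, F2, F3, F4) (G0, G1, G2, G3, G4).
              (F0 + G0, F1 + G1, F2 + G2, F3 + G3, F4 + G4)),
      smult = (\<lambda>a (F0, F1, F2, F3, F4).
              (a \<cdot>\<^sub>m F0, a \<cdot>\<^sub>m F1, a \<cdot>\<^sub>m F2, a \<cdot>\<^sub>m F3, a \<cdot>\<^sub>m F4)) \<rparr>"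

definition hom_dim :: "'a :: field quad \<Rightarrow> 'a quad \<Rightarrow> nat" where
  "hom_dim M X = vectorspace.dim class_ring (hom_space M X)"

lemma vectorspace_hom_space:
  fixes A B C D A' B' C' D' :: "'a :: field mat"
  assumes M: "A \<in> carrier_mat n0 n1" "B \<in> carrier_mat n0 n2"
      "C \<in> carrier_mat n0 n3" "D \<in> carrier_mat n0 n4"
    and X: "A' \<in> carrier_mat m0 m1" "B' \<in> carrier_mat m0 m2"
      "C' \<in> carrier_mat m0 m3" "D' \<in> carrier_mat m0 m4"
  shows "vectorspace class_ring (hom_space (A, B, C, D) (A', B', C', D'))"
    (is "vectorspace _ ?V")
proof -
  have dims: "dim_row A = n0" "dim_col A = n1" "dim_row A' = m0" "dim_col A' = m1"
    "dim_col B = n2" "dim_col B' = m2" "dim_col C = n3" "dim_col C' = m3"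
    "dim_col D = n4" "dim_col D' = m4"
    using M X by auto
  have add: "(F + G) * Y = Y' * (F1 + G1)"
    if "Y \<in> carrier_mat n0 k" "Y' \<in> carrier_mat m0 k'" "F * Y = Y' * F1" "G * Y = Y' * G1"
      "F \<in> carrier_mat m0 n0" "G \<in> carrier_mat m0 n0"
      "F1 \<in> carrier_mat k' k" "G1 \<in> carrier_mat k' k"
    for F G Y Y' F1 G1 :: "'a mat" and k k'
    using that(3,4) add_mult_distrib_mat[OF that(5,6,1)] mult_add_distrib_mat[OF that(2,7,8)]
    by simp
  have smult: "(a \<cdot>\<^sub>m F) * Y = Y' * (a \<cdot>\<^sub>m F1)"
    if "Y \<in> carrier_mat n0 k" "Y' \<in> carrier_mat m0 k'" "F * Y = Y' * F1"
      "F \<in> carrier_mat m0 n0" "F1 \<in> carrier_mat k' k"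
    for F Y Y' F1 :: "'a mat" and a k k'
    using that(3) mult_smult_assoc_mat[OF that(4,1)] mult_smult_distrib[OF that(2,5)] by simp
  have zero: "0\<^sub>m m0 n0 * Y = Y' * 0\<^sub>m k' k"
    if "Y \<in> carrier_mat n0 k" "Y' \<in> carrier_mat m0 k'" for Y Y' :: "'a mat" and k k'
    using that by simp
  note closed = add[OF M(1) X(1)] add[OF M(2) X(2)] add[OF M(3) X(3)] add[OF M(4) X(4)]
    smult[OF M(1) X(1)] smult[OF M(2) X(2)] smult[OF M(3) X(3)] smult[OF M(4) X(4)]
    zero[OF M(1) X(1)] zero[OF M(2) X(2)] zero[OF M(3) X(3)] zero[OF M(4) X(4)]
  have scalar_laws: "(a + b) \<cdot>\<^sub>m F = a \<cdot>\<^sub>m F + b \<cdot>\<^sub>m F" "(a * b) \<cdot>\<^sub>m F = a \<cdot>\<^sub>m (b \<cdot>\<^sub>m F)"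
    "1 \<cdot>\<^sub>m F = F" for a b and F :: "'a mat"
    by (auto intro!: eq_matI simp: algebra_simps)
  have scalar_distrib: "a \<cdot>\<^sub>m (F + G) = a \<cdot>\<^sub>m F + a \<cdot>\<^sub>m G"
    if "F \<in> carrier_mat m n" "G \<in> carrier_mat m n" for a m n and F G :: "'a mat"
    using that by (auto intro!: eq_matI simp: algebra_simps)
  have neg: "F + (- 1) \<cdot>\<^sub>m F = 0\<^sub>m m n" if "F \<in> carrier_mat m n" for m n and F :: "'a mat"
    using that by (auto intro!: eq_matI)
  have "module class_ring ?V"
  proof (rule module_criteria[OF class_cring.cring_axioms], goal_cases)
    case 3
    show ?case
    proof
      fix F assume F: "F \<in> carrier ?V"
      obtain F0 F1 F2 F3 F4 where F_eq: "F = (F0, F1, F2, F3, F4)" by (cases F)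
      let ?G = "((- 1) \<cdot>\<^sub>m F0, (- 1) \<cdot>\<^sub>m F1, (- 1) \<cdot>\<^sub>m F2, (- 1) \<cdot>\<^sub>m F3, (- 1) \<cdot>\<^sub>m F4)"
      have "?G \<in> carrier ?V"
        using F unfolding F_eq by (simp add: dims closed)
      moreover have "F \<oplus>\<^bsub>?V\<^esub> ?G = \<zero>\<^bsub>?V\<^esub>"
        using F unfolding F_eq by (simp add: dims neg)
      ultimately show "\<exists>G\<in>carrier ?V. F \<oplus>\<^bsub>?V\<^esub> G = \<zero>\<^bsub>?V\<^esub>" by blast
    qed
  next
    case 1 then show ?case by (simp add: dims closed)
  next
    case 2 then show ?case by (clarsimp simp: dims closed)
  next
    case 4 then show ?case by (clarsimp simp: dims closed)
  next
    case 5
    show ?case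
      by (simp add: dims, intro allI impI, elim conjE) (intro conjI comm_add_mat; assumption)
  next
    case 6
    show ?case
      by (simp add: dims, intro allI impI, elim conjE) (intro conjI assoc_add_mat; assumption)
  next
    case 7 then show ?case by (clarsimp simp: dims)
  next
    case 8 then show ?case by (clarsimp simp: dims scalar_laws)
  next
    case 9 then show ?case by (clarsimp simp: scalar_laws)
  next
    case 10 then show ?case by (clarsimp simp: dims scalar_laws)
  next
    case 11 then show ?case by (clarsimp simp: dims scalar_distrib)
  qed
  then show ?thesis
    by (simp add: vectorspace_def class_field)
qed


section \<open>The indecomposable modules\<close>

definition antidiag :: "nat \<Rightarrow> 'a :: {zero, one} mat" where
  "antidiag n = mat n n (\<lambda>(i, j). if i + j + 1 = n then 1 else 0)"

definition id_zero_col :: "nat \<Rightarrow> 'a :: {zero, one} mat" where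
  "id_zero_col n = hcat [1\<^sub>m n, 0\<^sub>m n 1]"

definition zero_col_id :: "nat \<Rightarrow> 'a :: {zero, one} mat" where
  "zero_col_id n = hcat [0\<^sub>m n 1, 1\<^sub>m n]"

text \<open>Used for \<open>j \<in> {1, 2, 3, 4}\<close>.\<close>

definition cyc :: "nat \<Rightarrow> 'a mat \<Rightarrow> 'a mat \<Rightarrow> 'a mat \<Rightarrow> 'a mat \<Rightarrow> 'a quad" where
  "cyc j a b c d = (if j = 1 then (a, b, c, d) else if j = 2 then (d, a, b, c)
                    else if j = 3 then (c, d, a, b) else (b, c, d, a))"

text \<open>\<open>postproj m j\<close> and \<open>preinj m j\<close> are the explicit matrix representatives of
  \<open>P(m, j) = \<tau>\<^sup>-\<^sup>m P(j)\<close> and \<open>I(m, j) = \<tau>\<^sup>m I(j)\<close> for the vertices \<open>j = 0, \<dots>, 4\<close>.\<close>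

definition postproj :: "nat \<Rightarrow> nat \<Rightarrow> 'a :: field quad" where
  "postproj m j =
    (if j = 0 then
       (vcat [1\<^sub>m m, 0\<^sub>m (m + 1) m],
        vcat [0\<^sub>m (m + 1) m, 1\<^sub>m m],
        vcat [0\<^sub>m 1 m, 1\<^sub>m m, antidiag m],
        vcat [1\<^sub>m m, antidiag m, 0\<^sub>m 1 m])
     else let n = m div 2 in
     if odd m then
       cyc j
        (vcat [0\<^sub>m 1 n, 1\<^sub>m n, 1\<^sub>m n, 0\<^sub>m 1 n])
        (vcat [1\<^sub>m (n + 1), 0\<^sub>m (n + 1) (n + 1)])
        (vcat [0\<^sub>m (n + 1) (n + 1), 1\<^sub>m (n + 1)])
        (vcat [1\<^sub>m (n + 1), 1\<^sub>m (n + 1)])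
     else
       cyc j
        (vcat [1\<^sub>m (n + 1), 0\<^sub>m n (n + 1)])
        (vcat [0\<^sub>m (n + 1) n, 1\<^sub>m n])
        (vcat [0\<^sub>m 1 n, 1\<^sub>m n, 1\<^sub>m n])
        (vcat [1\<^sub>m n, 0\<^sub>m 1 n, 1\<^sub>m n]))"

definition preinj :: "nat \<Rightarrow> nat \<Rightarrow> 'a :: field quad" where
  "preinj m j =
    (if j = 0 then
       (vcat [0\<^sub>m m (m + 1), 1\<^sub>m (m + 1)],
        vcat [1\<^sub>m (m + 1), 0\<^sub>m m (m + 1)],
        vcat [antidiag (m + 1), id_zero_col m],
        vcat [zero_col_id m, antidiag (m + 1)])
     else let n = m div 2 in
     if odd m then
       cyc j
        (vcat [0\<^sub>m (n + 1) n, 1\<^sub>m n])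
        (vcat [1\<^sub>m (n + 1), 0\<^sub>m n (n + 1)])
        (vcat [1\<^sub>m (n + 1), zero_col_id n])
        (vcat [1\<^sub>m (n + 1), id_zero_col n])
     else
       cyc j
        (vcat [id_zero_col n, zero_col_id n])
        (vcat [0\<^sub>m n n, 1\<^sub>m n])
        (vcat [1\<^sub>m n, 0\<^sub>m n n])
        (vcat [1\<^sub>m n, 1\<^sub>m n]))"

text \<open>\<open>reg_hom l \<mu>\<close> is \<open>R(l, \<mu>)\<close> in the homogeneous tube of \<open>\<mu> \<noteq> 0, 1\<close>, and
  \<open>reg_exc s m pt\<close> is \<open>R(s, m, pt)\<close> in the rank 2 tube of \<open>pt \<in> {0, 1, \<infinity>}\<close>, with
  \<open>s\<close> in \<open>\<int>/2\<int>\<close> and \<open>m \<ge> 1\<close> the quasi-length.\<close>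

definition reg_hom :: "nat \<Rightarrow> 'a :: field \<Rightarrow> 'a quad" where
  "reg_hom l \<mu> = (vcat [1\<^sub>m l, 0\<^sub>m l l], vcat [0\<^sub>m l l, 1\<^sub>m l],
                  vcat [1\<^sub>m l, 1\<^sub>m l], vcat [jordan_block l \<mu>, 1\<^sub>m l])"

datatype exc_pt = Pt0 | Pt1 | PtInf

definition reg_exc :: "bit \<Rightarrow> nat \<Rightarrow> exc_pt \<Rightarrow> 'a :: field quad" where
  "reg_exc s m pt =
    (if even m then
      (let l = m div 2;
           p = vcat [1\<^sub>m l, 0\<^sub>m l l];
           q = vcat [0\<^sub>m l l, 1\<^sub>m l];
           e = vcat [1\<^sub>m l, 1\<^sub>m l];
           j = vcat [jordan_block l 0, 1\<^sub>m l]
       in case pt of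
            Pt0 \<Rightarrow> if s = 0 then (p, q, e, j) else (q, p, j, e)
          | Pt1 \<Rightarrow> if s = 0 then (q, j, p, e) else (p, e, q, j)
          | PtInf \<Rightarrow> if s = 0 then (q, p, e, j) else (p, q, j, e))
     else
      (let l = (m + 1) div 2;
           f = vcat [1\<^sub>m (l - 1), 0\<^sub>m 1 (l - 1), 1\<^sub>m (l - 1)];
           g = vcat [id_zero_col (l - 1), 1\<^sub>m l];
           p = vcat [1\<^sub>m (l - 1), 0\<^sub>m l (l - 1)];
           q = vcat [0\<^sub>m (l - 1) l, 1\<^sub>m l]
       in case pt of
            Pt0 \<Rightarrow> if s = 0 then (f, g, p, q) else (g, f, q, p)
          | Pt1 \<Rightarrow> if s = 0 then (g, q, f, p) else (f, p, g, q)
          | PtInf \<Rightarrow> if s = 0 then (g, f, p, q) else (f, g, q, p)))"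

end

theory Submission
  imports Defs
begin

text \<open>For a matrix \<open>N\<close> the corank is the dimension of the left kernel \<open>{x. x N = 0}\<close>. On the other side, the
  maps \<open>A', B', C', D'\<close> of each module \<open>X\<close> in question (apart from \<open>I(0,j)\<close>, \<open>j \<ge> 1\<close>) are injective, so a homomorphism \<open>M \<rightarrow> X\<close> is
  determined by its component \<open>F\<^sub>0\<close>, and \<open>F\<^sub>0\<close> extends to a homomorphism iff the columns of
  \<open>F\<^sub>0 A, F\<^sub>0 B, F\<^sub>0 C, F\<^sub>0 D\<close> lie in the column spaces of \<open>A', B', C', D'\<close>. Written in terms of the rows of \<open>F\<^sub>0\<close>,
  these conditions are the equations \<open>x N = 0\<close> for the block matrix \<open>N\<close> of the formula, where \<open>x\<close> lists
  the rows of \<open>F\<^sub>0\<close> in a permuted order \<open>\<sigma>\<close>. The cases that differ only by a permutation of the four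
  arms are treated together, and \<open>R(s,2l,\<lambda>)\<close> with \<open>\<lambda> \<in> {0,1,\<infinity>}\<close> is, up to such a permutation, given by the
  matrices of \<open>R(l,\<mu>)\<close> at \<open>\<mu> = 0\<close>.\<close>

text \<open>The order \<sigma> is dictated by the equations of the column spaces. Those of the
  representatives say w p = 0 or w p = w q, except that a Jordan block gives w p = \<mu> w q + w q'.
  The equations with two sides tie the rows of F_0 into a chain. In most families \<sigma> numbers
  the rows along this chain; for P(n,0) and I(n,0) with n >= 1 it starts at the middle row and
  numbers both halves simultaneously by distance from it. Tied rows then lie in the same block row
  of the bidiagonal matrix or in two neighbouring ones. The two sides of an equation enter one block
  of columns with opposite signs, and the corner block E or F is the part that crosses to the
  neighbouring block row. Equations of the form w p = 0 either stay inside one block row or sit at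
  an end of the chain; the ends account for the separate first block Z' and for the additional last
  block column of \<open>\<M>\<^sub>3\<close>.\<close>

section \<open>Left kernels and homomorphism spaces\<close>

text \<open>A maximal independent set of columns of \<open>N\<close>, extended by unit vectors to a
  basis, gives an invertible \<open>P\<close> whose first \<open>r\<close> columns span the column
  space. So x N = 0 iff the first \<open>r\<close> entries of \<open>P\<^sup>T *\<^sub>v x\<close>
  vanish, and the other n - r entries are free parameters.\<close>

lemma left_kernel_parametrization:
  fixes N :: "'a :: field mat"
  assumes N: "N \<in> carrier_mat n m"
  obtains G where "G \<in> carrier_mat n (cor N)" "inj_on (\<lambda>z. G *\<^sub>v z) (carrier_vec (cor N))"
    "(\<lambda>z. G *\<^sub>v z) ` carrier_vec (cor N) = {x \<in> carrier_vec n. \<forall>j<m. x \<bullet> col N j = 0}"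
proof -
  interpret vec_space "TYPE('a)" n .
  let ?C = "set (cols N)" and ?U = "set (unit_vecs n) :: 'a vec set"
  let ?P = "\<lambda>S T. T \<subseteq> S \<and> lin_indpt T"
  have CC: "?C \<subseteq> carrier_vec n" using N cols_dim by blast
  have UC: "?U \<subseteq> carrier_vec n" by (rule unit_vecs_carrier)
  have "lin_indpt {}" by (simp add: lin_dep_def)
  then obtain S where S: "maximal S (?P ?C)"
    using maximal_exists_superset[of ?C "?P ?C" "{}"] by blast
  then have SC: "S \<subseteq> ?C" "lin_indpt S" unfolding maximal_def by blast+
  obtain T where T: "maximal T (?P (?C \<union> ?U))" "S \<subseteq> T"
    using maximal_exists_superset[of "?C \<union> ?U" "?P (?C \<union> ?U)" S] SC by blast
  then have TC: "T \<subseteq> ?C \<union> ?U" "lin_indpt T" unfolding maximal_def by blast+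
  have max_span: "Y \<subseteq> span X" if "maximal X (?P Y)" "Y \<subseteq> carrier_vec n" for X Y
  proof
    fix y assume y: "y \<in> Y"
    have X: "X \<subseteq> Y" "lin_indpt X" using that(1) unfolding maximal_def by blast+
    show "y \<in> span X"
    proof (rule ccontr)
      assume ny: "y \<notin> span X"
      have Xc: "X \<subseteq> carrier_vec n" using X(1) that(2) by blast
      have "lin_indpt (X \<union> {y})"
        using lin_dep_iff_in_span[OF Xc X(2), of y] ny y that(2) span_mem[OF Xc] by blast
      then have "X \<union> {y} = X"
        using that(1) y X unfolding maximal_def by blast
      then show False using ny span_mem[OF Xc] by blast
    qed
  qed
  have Tc: "T \<subseteq> carrier_vec n" using TC(1) CC UC by blast
  have Sc: "S \<subseteq> carrier_vec n" using SC(1) CC by blast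
  have "?U \<subseteq> span T" using max_span[OF T(1)] CC UC by blast
  then have "carrier_vec n \<subseteq> span T"
    unfolding span_unit_vecs_is_carrier[symmetric] by (rule span_subsetI[OF Tc])
  then have "span T = carrier_vec n" using span_closed[OF Tc] by (intro equalityI subsetI) auto
  then have basisT: "basis T" unfolding basis_def using TC(2) Tc by simp
  have finT: "finite T" using finite_subset[OF TC(1)] by simp
  then have finS: "finite S" using finite_subset[OF T(2)] by simp
  have cardT: "card T = n" using dim_basis[OF finT basisT] dim_is_n by simp
  have rank: "rank N = card S" by (rule rank_card_indpt[OF N S])
  obtain ss where ss: "set ss = S" "distinct ss" using finite_distinct_list[OF finS] by blast
  obtain ts where ts: "set ts = T - S" "distinct ts" using finite_distinct_list[OF finite_Diff[OF finT]] by blast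
  \<comment> \<open>\<open>S\<close> is listed first, so that it supplies the first \<open>r\<close>
    columns of \<open>P\<close>.\<close>
  define us where "us = ss @ ts"
  define r where "r = card S"
  have us: "set us = T" "distinct us" using ss ts T(2) by (auto simp: us_def)
  have lens: "length ss = r" "length us = n"
    using ss us cardT distinct_card[of ss] distinct_card[of us] by (simp_all add: r_def)
  then have rn: "r \<le> n" by (auto simp: us_def)
  define P where "P = mat_of_cols n us"
  have P: "P \<in> carrier_mat n n" and colsP: "cols P = us"
    unfolding P_def using mat_of_cols_carrier(1)[of n us] lens cols_mat_of_cols[of us n] Tc us(1)
    by simp_all
  have "rank P = n" by (rule lin_indpt_full_rank[OF P]) (simp_all add: colsP us TC(2))
  then have "det P \<noteq> 0" using det_rank_iff[OF P] by simp
  then obtain Q where Q: "Q \<in> carrier_mat n n" "Q * P = 1\<^sub>m n" "P * Q = 1\<^sub>m n"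
    using det_non_zero_imp_unit[OF P, of "()"] that
    unfolding Units_def ring_mat_def by auto
  have cor: "cor N = n - r" using N rank by (simp add: cor_def r_def)
  \<comment> \<open>The last n - r columns of \<open>Q\<^sup>T\<close>, the inverse of
    \<open>P\<^sup>T\<close>.\<close>
  define G where "G = mat n (n - r) (\<lambda>(i, j). Q $$ (r + j, i))"
  have Gz: "G *\<^sub>v z = Q\<^sup>T *\<^sub>v (0\<^sub>v r @\<^sub>v z)" if "z \<in> carrier_vec (n - r)" for z
  proof (rule eq_vecI)
    fix i assume "i < dim_vec (Q\<^sup>T *\<^sub>v (0\<^sub>v r @\<^sub>v z))"
    then have i: "i < n" using Q by simp
    have "(\<Sum>j = 0..<n. Q $$ (j, i) * (0\<^sub>v r @\<^sub>v z) $ j)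
      = (\<Sum>j = 0..<r. Q $$ (j, i) * (0\<^sub>v r @\<^sub>v z) $ j)
        + (\<Sum>j = r..<n. Q $$ (j, i) * (0\<^sub>v r @\<^sub>v z) $ j)"
      by (rule sum.atLeastLessThan_concat[OF le0 rn, symmetric])
    also have "(\<Sum>j = 0..<r. Q $$ (j, i) * (0\<^sub>v r @\<^sub>v z) $ j) = 0"
      using that rn by (intro sum.neutral) auto
    also have "(\<Sum>j = r..<n. Q $$ (j, i) * (0\<^sub>v r @\<^sub>v z) $ j)
      = (\<Sum>j = 0..<n - r. Q $$ (r + j, i) * z $ j)"
      using that rn sum.shift_bounds_nat_ivl[of "\<lambda>j. Q $$ (j, i) * (0\<^sub>v r @\<^sub>v z) $ j" 0 r "n - r"]
      by (auto simp: add.commute intro!: sum.cong)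
    finally show "(G *\<^sub>v z) $ i = (Q\<^sup>T *\<^sub>v (0\<^sub>v r @\<^sub>v z)) $ i"
      using i that Q rn by (simp add: G_def scalar_prod_def)
  qed (use Q in \<open>simp add: G_def\<close>)
  have PQ: "P\<^sup>T * Q\<^sup>T = 1\<^sub>m n" "Q\<^sup>T * P\<^sup>T = 1\<^sub>m n"
    using Q(2,3) transpose_mult[OF Q(1) P] transpose_mult[OF P Q(1)] by (metis transpose_one)+
  have PQv: "P\<^sup>T *\<^sub>v (Q\<^sup>T *\<^sub>v y) = y" "Q\<^sup>T *\<^sub>v (P\<^sup>T *\<^sub>v y) = y" if "y \<in> carrier_vec n" for y
    using PQ that P Q
      assoc_mult_mat_vec[of "P\<^sup>T" n n "Q\<^sup>T" n y] assoc_mult_mat_vec[of "Q\<^sup>T" n n "P\<^sup>T" n y]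
    by simp_all
  have ker: "(\<forall>j<m. x \<bullet> col N j = 0) \<longleftrightarrow> (\<forall>i<r. (P\<^sup>T *\<^sub>v x) $ i = 0)"
    if x: "x \<in> carrier_vec n" for x
  proof -
    have oc: "x \<in> orthogonal_complement W \<longleftrightarrow> (\<forall>y\<in>W. x \<bullet> y = 0)" for W
      using x by (simp add: orthogonal_complement_def)
    \<comment> \<open>The set of columns lies between \<open>S\<close> and its span, and
      orthogonality to \<open>S\<close> extends to the span.\<close>
    have "orthogonal_complement ?C = orthogonal_complement S"
      using in_orthogonal_complement_span[OF Sc]
        orthogonal_complement_subset[OF max_span[OF S CC]] orthogonal_complement_subset[OF SC(1)]
      by blast
    then have "(\<forall>y\<in>?C. x \<bullet> y = 0) \<longleftrightarrow> (\<forall>y\<in>S. x \<bullet> y = 0)" using oc by metis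
    moreover have "(\<forall>y\<in>?C. x \<bullet> y = 0) \<longleftrightarrow> (\<forall>j<m. x \<bullet> col N j = 0)"
      using N by (auto simp: cols_def)
    moreover have "(\<forall>y\<in>S. x \<bullet> y = 0) \<longleftrightarrow> (\<forall>i<r. x \<bullet> us ! i = 0)"
      unfolding ss(1)[symmetric] all_set_conv_all_nth using lens by (simp add: us_def nth_append)
    moreover have "(P\<^sup>T *\<^sub>v x) $ i = x \<bullet> us ! i" if "i < r" for i
    proof -
      have "us ! i \<in> carrier_vec n" using that rn lens us Tc by (metis nth_mem order_less_le_trans subset_iff)
      moreover have "(P\<^sup>T *\<^sub>v x) $ i = us ! i \<bullet> x" using that rn P x lens by (simp flip: colsP)
      ultimately show ?thesis using comm_scalar_prod x by metis
    qed
    ultimately show ?thesis by simp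
  qed
  have pad: "0\<^sub>v r @\<^sub>v z \<in> carrier_vec n" if "z \<in> carrier_vec (n - r)" for z :: "'a vec"
    using that rn by (intro carrier_vecI) simp
  show thesis
  proof
    show G: "G \<in> carrier_mat n (cor N)" by (simp add: G_def cor)
    show "inj_on (\<lambda>z. G *\<^sub>v z) (carrier_vec (cor N))"
    proof (rule inj_onI)
      fix y z assume yz: "y \<in> carrier_vec (cor N)" "z \<in> carrier_vec (cor N)" "G *\<^sub>v y = G *\<^sub>v z"
      then have "Q\<^sup>T *\<^sub>v (0\<^sub>v r @\<^sub>v y) = Q\<^sup>T *\<^sub>v (0\<^sub>v r @\<^sub>v z)" using Gz by (simp add: cor)
      moreover have "0\<^sub>v r @\<^sub>v y \<in> carrier_vec n" "0\<^sub>v r @\<^sub>v z \<in> carrier_vec n"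
        using yz(1,2) pad by (simp_all only: cor)
      ultimately have "0\<^sub>v r @\<^sub>v y = 0\<^sub>v r @\<^sub>v z" using PQv(1) by metis
      then show "y = z" using append_vec_eq[of "0\<^sub>v r" r "0\<^sub>v r" y z] by simp
    qed
    show "(\<lambda>z. G *\<^sub>v z) ` carrier_vec (cor N) = {x \<in> carrier_vec n. \<forall>j<m. x \<bullet> col N j = 0}"
      (is "?L = ?R")
    proof (intro equalityI subsetI)
      fix x assume "x \<in> ?L"
      then obtain z where z: "z \<in> carrier_vec (n - r)" "x = Q\<^sup>T *\<^sub>v (0\<^sub>v r @\<^sub>v z)"
        using Gz by (auto simp: cor)
      then have "P\<^sup>T *\<^sub>v x = 0\<^sub>v r @\<^sub>v z" "x \<in> carrier_vec n"
        using PQv(1)[OF pad[OF z(1)]] pad[OF z(1)] Q(1) by simp_all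
      then show "x \<in> ?R" using ker[of x] rn z(1) by simp
    next
      fix x assume x: "x \<in> ?R"
      define y where "y = P\<^sup>T *\<^sub>v x"
      have y: "y \<in> carrier_vec n" "Q\<^sup>T *\<^sub>v y = x" "\<forall>i<r. y $ i = 0"
        using x ker[of x] PQv(2)[of x] P by (simp_all add: y_def)
      have "y = 0\<^sub>v r @\<^sub>v vec_last y (n - r)"
        using y rn by (intro eq_vecI) (auto simp: vec_last_def)
      then have "x = G *\<^sub>v vec_last y (n - r)" using Gz y(2) vec_last_carrier by metis
      then show "x \<in> ?L" by (auto simp: cor)
    qed
  qed
qed

text \<open>Dimension by transport along a linear bijection from k^n. It serves the general argument
  in \<open>hom_dim_eq_cor\<close> and also the modules I(0,j), j >= 1, where F_0 does not determine
  the homomorphism.\<close>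

lemma hom_dim_eqI:
  fixes A B C D a b c d :: "'a :: field mat" and \<phi> :: "'a vec \<Rightarrow> _"
  assumes M: "A \<in> carrier_mat n0 n1" "B \<in> carrier_mat n0 n2"
      "C \<in> carrier_mat n0 n3" "D \<in> carrier_mat n0 n4"
    and X: "a \<in> carrier_mat m0 m1" "b \<in> carrier_mat m0 m2"
      "c \<in> carrier_mat m0 m3" "d \<in> carrier_mat m0 m4"
    and inj: "inj_on \<phi> (carrier_vec n)"
    and im: "\<phi> ` carrier_vec n = carrier (hom_space (A, B, C, D) (a, b, c, d))"
    and add: "\<And>v w. v \<in> carrier_vec n \<Longrightarrow> w \<in> carrier_vec n \<Longrightarrow>
      \<phi> (v + w) = \<phi> v \<oplus>\<^bsub>hom_space (A, B, C, D) (a, b, c, d)\<^esub> \<phi> w"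
    and smult: "\<And>r v. v \<in> carrier_vec n \<Longrightarrow>
      \<phi> (r \<cdot>\<^sub>v v) = r \<odot>\<^bsub>hom_space (A, B, C, D) (a, b, c, d)\<^esub> \<phi> v"
  shows "hom_dim (A, B, C, D) (a, b, c, d) = n"
proof -
  let ?W = "hom_space (A, B, C, D) (a, b, c, d)"
  interpret V: vec_space "TYPE('a)" n .
  interpret W: vectorspace class_ring ?W by (rule vectorspace_hom_space[OF M X])
  interpret linear_map class_ring "module_vec TYPE('a) n" ?W \<phi>
  proof unfold_locales
    show "\<phi> \<in> LinearCombinations.module_hom class_ring (module_vec TYPE('a) n) ?W"
      unfolding LinearCombinations.module_hom_def using im add smult
      by (auto simp: module_vec_simps simp del: hom_space.simps)
  qed
  have "V.dim = W.dim"
    by (rule dim_eq) (use inj im in \<open>simp_all add: module_vec_simps del: hom_space.simps\<close>)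
  then show ?thesis by (simp add: hom_dim_def V.dim_is_n del: hom_space.simps)
qed

text \<open>A row vector of length \<open>m * n\<close> is represented by its \<open>m\<close> blocks of length \<open>n\<close>: \<open>X P r\<close> is entry
  \<open>r\<close> of block \<open>P\<close>. Then \<open>blk_comb n X N j\<close> is entry \<open>j\<close> of the product of this vector with \<open>N\<close>.\<close>

definition col_comb :: "(nat \<Rightarrow> 'a) \<Rightarrow> 'a :: comm_ring_1 mat \<Rightarrow> nat \<Rightarrow> 'a" where
  "col_comb v A j = (\<Sum>r<dim_row A. v r * A $$ (r, j))"

definition blk_comb :: "nat \<Rightarrow> (nat \<Rightarrow> nat \<Rightarrow> 'a) \<Rightarrow> 'a :: comm_ring_1 mat \<Rightarrow> nat \<Rightarrow> 'a" where
  "blk_comb n X N j = (\<Sum>i<dim_row N. X (i div n) (i mod n) * N $$ (i, j))"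

text \<open>Membership in the column space of \<open>a\<close>. Vectors are functions on indices,
  read only within the dimensions of \<open>a\<close>, so shifting and reordering them creates no
  carrier conditions.\<close>

definition in_range :: "'a :: comm_ring_1 mat \<Rightarrow> (nat \<Rightarrow> 'a) \<Rightarrow> bool" where
  "in_range a w \<longleftrightarrow> (\<exists>g. \<forall>p<dim_row a. w p = (\<Sum>j<dim_col a. a $$ (p, j) * g j))"

text \<open>Over a field this is injectivity. The left inverse \<open>L\<close> in hand makes the
  component F_i = L (F_0 A) a linear function of F_0.\<close>

definition left_invertible :: "'a :: comm_ring_1 mat \<Rightarrow> bool" where
  "left_invertible a \<longleftrightarrow> (\<exists>L \<in> carrier_mat (dim_col a) (dim_row a). L * a = 1\<^sub>m (dim_col a))"

text \<open>\<open>presents n m N S\<close> says that the left kernel of \<open>N\<close> is, after a permutation of the blocks, the set of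
  components \<open>F\<^sub>0\<close> of homomorphisms. Taking the set of pairs of corresponding matrices of \<open>M\<close> and \<open>X\<close>
  as argument makes the notion symmetric in the four arms.\<close>

definition presents :: "nat \<Rightarrow> nat \<Rightarrow> 'a :: field mat \<Rightarrow> ('a mat \<times> 'a mat) set \<Rightarrow> bool" where
  "presents n m N S \<longleftrightarrow> dim_row N = m * n \<and> (\<forall>(A, a) \<in> S. dim_row a = m \<and> left_invertible a) \<and>
    (\<exists>\<sigma>. bij_betw \<sigma> {..<m} {..<m} \<and> (\<forall>X. (\<forall>j<dim_col N. blk_comb n X N j = 0) \<longleftrightarrow>
      (\<forall>(A, a) \<in> S. \<forall>j<dim_col A. in_range a (\<lambda>p. col_comb (X (\<sigma> p)) A j))))"

text \<open>The equation F A = a K decouples: column j of K is the coefficient vector that expresses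
  column j of F A through the columns of \<open>a\<close>.\<close>

lemma mult_in_range_iff:
  fixes F A a :: "'a :: field mat"
  assumes F: "F \<in> carrier_mat m n" and A: "A \<in> carrier_mat n l" and a: "a \<in> carrier_mat m k"
  shows "(\<exists>K \<in> carrier_mat k l. F * A = a * K) \<longleftrightarrow>
    (\<forall>j<l. in_range a (\<lambda>p. col_comb (\<lambda>r. F $$ (p, r)) A j))"
proof -
  have FA: "(F * A) $$ (p, j) = col_comb (\<lambda>r. F $$ (p, r)) A j" if "p < m" "j < l" for p j
    using that F A by (simp add: scalar_prod_def col_comb_def atLeast0LessThan)
  have aK: "(a * K) $$ (p, j) = (\<Sum>i<k. a $$ (p, i) * K $$ (i, j))"
    if "p < m" "j < l" "K \<in> carrier_mat k l" for p j K
    using that a by (simp add: scalar_prod_def atLeast0LessThan)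
  show ?thesis
  proof
    assume "\<exists>K \<in> carrier_mat k l. F * A = a * K"
    then obtain K where K: "K \<in> carrier_mat k l" "F * A = a * K" by blast
    show "\<forall>j<l. in_range a (\<lambda>p. col_comb (\<lambda>r. F $$ (p, r)) A j)"
    proof (intro allI impI)
      fix j assume "j < l"
      then show "in_range a (\<lambda>p. col_comb (\<lambda>r. F $$ (p, r)) A j)"
        unfolding in_range_def using a FA aK[OF _ _ K(1)] K(2)
        by (intro exI[of _ "\<lambda>i. K $$ (i, j)"]) (metis carrier_matD)
    qed
  next
    assume "\<forall>j<l. in_range a (\<lambda>p. col_comb (\<lambda>r. F $$ (p, r)) A j)"
    then have "\<forall>j. \<exists>g. j < l \<longrightarrow> (\<forall>p<m. col_comb (\<lambda>r. F $$ (p, r)) A j = (\<Sum>i<k. a $$ (p, i) * g i))"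
      using a unfolding in_range_def by (metis carrier_matD)
    then obtain g where g: "\<And>j p. j < l \<Longrightarrow> p < m \<Longrightarrow>
      col_comb (\<lambda>r. F $$ (p, r)) A j = (\<Sum>i<k. a $$ (p, i) * g j i)" by metis
    let ?K = "mat k l (\<lambda>(i, j). g j i)"
    have "F * A = a * ?K"
    proof (rule eq_matI)
      fix p j assume pj: "p < dim_row (a * ?K)" "j < dim_col (a * ?K)"
      then have "p < m" "j < l" using a by auto
      then show "(F * A) $$ (p, j) = (a * ?K) $$ (p, j)"
        using FA aK[of p j ?K] g by simp
    qed (use F A a in auto)
    then show "\<exists>K \<in> carrier_mat k l. F * A = a * K" by (intro bexI[of _ ?K]) auto
  qed
qed

lemma mult_left_inverse_cancel:
  fixes F A a L K :: "'a :: field mat"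
  assumes F: "F \<in> carrier_mat m n" and A: "A \<in> carrier_mat n l" and a: "a \<in> carrier_mat m k"
    and L: "L \<in> carrier_mat k m" "L * a = 1\<^sub>m k" and K: "K \<in> carrier_mat k l" "F * A = a * K"
  shows "L * (F * A) = K"
  using assoc_mult_mat[OF L(1) a K(1)] L(2) K by simp

text \<open>As L a = 1, the only candidate for K is L (F A). The existence statement thus becomes
  one equation, the one that defines membership in the hom space.\<close>

lemma mult_in_range_left_inverse_iff:
  fixes F A a L :: "'a :: field mat"
  assumes F: "F \<in> carrier_mat m n" and A: "A \<in> carrier_mat n l" and a: "a \<in> carrier_mat m k"
    and L: "L \<in> carrier_mat k m" "L * a = 1\<^sub>m k"
  shows "(\<forall>j<l. in_range a (\<lambda>p. col_comb (\<lambda>r. F $$ (p, r)) A j)) \<longleftrightarrow> F * A = a * (L * (F * A))"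
  using mult_left_inverse_cancel[OF F A a L] mult_in_range_iff[OF F A a]
    mult_carrier_mat[OF L(1) mult_carrier_mat[OF F A]] by metis


text \<open>The bijection from k^(cor N) is a composite: \<open>G\<close> parametrizes the left
  kernel, \<open>F\<close> arranges a kernel vector into the rows of F_0, and the left inverses
  supply the other four components.\<close>

lemma hom_dim_eq_cor:
  fixes A B C D a b c d N :: "'a :: field mat"
  assumes M: "A \<in> carrier_mat n0 n1" "B \<in> carrier_mat n0 n2"
      "C \<in> carrier_mat n0 n3" "D \<in> carrier_mat n0 n4"
    and N: "presents n0 m N {(A, a), (B, b), (C, c), (D, d)}"
  shows "hom_dim (A, B, C, D) (a, b, c, d) = cor N"
proof -
  define w where "w = dim_col N"
  note N' = N[unfolded presents_def]
  note Nd = N'[THEN conjunct1] and ad = N'[THEN conjunct2, THEN conjunct1]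
  have Nc: "N \<in> carrier_mat (m * n0) w" unfolding w_def by (rule carrier_matI[OF Nd refl])
  define m1 m2 m3 m4 where "m1 = dim_col a" and "m2 = dim_col b" and "m3 = dim_col c" and "m4 = dim_col d"
  then have X: "a \<in> carrier_mat m m1" "b \<in> carrier_mat m m2"
      "c \<in> carrier_mat m m3" "d \<in> carrier_mat m m4"
    using ad by (auto intro!: carrier_matI)
  obtain La Lb Lc Ld where L: "La \<in> carrier_mat m1 m" "La * a = 1\<^sub>m m1"
      "Lb \<in> carrier_mat m2 m" "Lb * b = 1\<^sub>m m2" "Lc \<in> carrier_mat m3 m" "Lc * c = 1\<^sub>m m3"
      "Ld \<in> carrier_mat m4 m" "Ld * d = 1\<^sub>m m4"
  proof -
    have "\<exists>L \<in> carrier_mat k m. L * a' = 1\<^sub>m k"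
      if "left_invertible a'" "a' \<in> carrier_mat m k" for a' :: "'a mat" and k
      using that by (auto simp: left_invertible_def)
    moreover have "left_invertible a" "left_invertible b" "left_invertible c" "left_invertible d"
      using ad by simp_all
    ultimately show thesis using X that by metis
  qed
  obtain \<sigma> where \<sigma>: "bij_betw \<sigma> {..<m} {..<m}"
    and ker: "\<And>X. (\<forall>j<w. blk_comb n0 X N j = 0) \<longleftrightarrow>
      (\<forall>(A, a) \<in> {(A, a), (B, b), (C, c), (D, d)}. \<forall>j<dim_col A. in_range a (\<lambda>p. col_comb (X (\<sigma> p)) A j))"
    using N'[THEN conjunct2, THEN conjunct2] unfolding w_def by blast
  have \<sigma>_less: "\<sigma> p < m" if "p < m" for p using \<sigma> that by (auto simp: bij_betw_def)
  have idx: "P * n0 + r < m * n0" if "P < m" "r < n0" for P r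
  proof -
    have "P * n0 + r < Suc P * n0" using that by simp
    also have "\<dots> \<le> m * n0" using that by (intro mult_le_mono1) simp
    finally show ?thesis .
  qed
  \<comment> \<open>Row p of F_0 is block \<sigma> p of \<open>x\<close>; \<open>\<psi>\<close> adds
    the components forced by the left inverses.\<close>
  define F where "F x = mat m n0 (\<lambda>(p, r). x $ (\<sigma> p * n0 + r))" for x :: "'a vec"
  define \<psi> where "\<psi> x = (F x, La * (F x * A), Lb * (F x * B), Lc * (F x * C), Ld * (F x * D))" for x
  have Fc: "F x \<in> carrier_mat m n0" for x by (simp add: F_def)
  have Fadd: "F (x + y) = F x + F y" if "x \<in> carrier_vec (m * n0)" "y \<in> carrier_vec (m * n0)" for x y
    using that idx \<sigma>_less by (intro eq_matI) (auto simp: F_def)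
  have Fsmult: "F (r \<cdot>\<^sub>v x) = r \<cdot>\<^sub>m F x" if "x \<in> carrier_vec (m * n0)" for x r
    using that idx \<sigma>_less by (intro eq_matI) (auto simp: F_def)
  have Finj: "x = y" if "F x = F y" "x \<in> carrier_vec (m * n0)" "y \<in> carrier_vec (m * n0)" for x y
  proof (rule eq_vecI)
    fix i assume "i < dim_vec y"
    then have i: "i < m * n0" using that by simp
    \<comment> \<open>With \<open>n0 > 0\<close>, division by \<open>n0\<close> recovers the block
      of \<open>i\<close> and its position in the block.\<close>
    then have "n0 > 0" by (cases n0) auto
    have "i div n0 < m" using i by (simp add: less_mult_imp_div_less)
    then obtain p where p: "p < m" "\<sigma> p = i div n0" using \<sigma> by (metis bij_betw_iff_bijections lessThan_iff)
    have "F x $$ (p, i mod n0) = F y $$ (p, i mod n0)" using that by simp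
    then show "x $ i = y $ i" using p \<open>n0 > 0\<close> by (simp add: F_def)
  qed (use that in simp)
  have Fsurj: "\<exists>x \<in> carrier_vec (m * n0). F x = F0" if "F0 \<in> carrier_mat m n0" for F0
  proof -
    define \<tau> where "\<tau> = inv_into {..<m} \<sigma>"
    have \<tau>: "\<tau> (\<sigma> p) = p" if "p < m" for p
      using \<sigma> that by (simp add: \<tau>_def bij_betw_def inv_into_f_f)
    let ?x = "vec (m * n0) (\<lambda>i. F0 $$ (\<tau> (i div n0), i mod n0))"
    have "F ?x = F0"
      using that idx \<sigma>_less \<tau> by (intro eq_matI) (auto simp: F_def)
    then show ?thesis by (intro bexI[of _ ?x]) auto
  qed
  have kerF: "(\<forall>j<w. x \<bullet> col N j = 0) \<longleftrightarrow> \<psi> x \<in> carrier (hom_space (A, B, C, D) (a, b, c, d))"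
    if x: "x \<in> carrier_vec (m * n0)" for x
  proof -
    define X where "X P r = x $ (P * n0 + r)" for P r
    have "x \<bullet> col N j = blk_comb n0 X N j" if "j < w" for j
      using Nc x that by (simp add: scalar_prod_def blk_comb_def X_def atLeast0LessThan)
    moreover have "in_range a' (\<lambda>p. col_comb (X (\<sigma> p)) A' j)
        \<longleftrightarrow> in_range a' (\<lambda>p. col_comb (\<lambda>r. F x $$ (p, r)) A' j)"
      if "a' \<in> carrier_mat m k" "A' \<in> carrier_mat n0 l" for A' a' j k l
      using that by (simp add: in_range_def F_def X_def col_comb_def)
    ultimately have "(\<forall>j<w. x \<bullet> col N j = 0) \<longleftrightarrow>
      F x * A = a * (La * (F x * A)) \<and> F x * B = b * (Lb * (F x * B)) \<and>
      F x * C = c * (Lc * (F x * C)) \<and> F x * D = d * (Ld * (F x * D))"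
      using ker[of X] M X mult_in_range_left_inverse_iff[OF Fc M(1) X(1) L(1,2), of x]
        mult_in_range_left_inverse_iff[OF Fc M(2) X(2) L(3,4), of x]
        mult_in_range_left_inverse_iff[OF Fc M(3) X(3) L(5,6), of x]
        mult_in_range_left_inverse_iff[OF Fc M(4) X(4) L(7,8), of x]
      by simp
    then show ?thesis using M X L Fc[of x] by (simp add: \<psi>_def)
  qed
  obtain G where G: "G \<in> carrier_mat (m * n0) (cor N)" "inj_on (\<lambda>z. G *\<^sub>v z) (carrier_vec (cor N))"
    "(\<lambda>z. G *\<^sub>v z) ` carrier_vec (cor N) = {x \<in> carrier_vec (m * n0). \<forall>j<w. x \<bullet> col N j = 0}"
    by (rule left_kernel_parametrization[OF Nc])
  have Gz: "G *\<^sub>v z \<in> carrier_vec (m * n0)" for z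
    using G(1) by (intro carrier_vecI) simp
  show ?thesis
  proof (rule hom_dim_eqI[OF M X, of "\<lambda>z. \<psi> (G *\<^sub>v z)"])
    show "inj_on (\<lambda>z. \<psi> (G *\<^sub>v z)) (carrier_vec (cor N))"
      using G(2) Finj[OF _ Gz Gz] by (auto simp: inj_on_def \<psi>_def)
    show "(\<lambda>z. \<psi> (G *\<^sub>v z)) ` carrier_vec (cor N) = carrier (hom_space (A, B, C, D) (a, b, c, d))"
      (is "?I = ?H")
    proof (intro equalityI subsetI)
      fix h assume "h \<in> ?I"
      then show "h \<in> ?H" using G(3) kerF by blast
    next
      fix h assume h: "h \<in> ?H"
      obtain F0 F1 F2 F3 F4 where hF: "h = (F0, F1, F2, F3, F4)" by (cases h)
      have F0: "F0 \<in> carrier_mat m n0" using h M X by (simp add: hF)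
      obtain x where x: "x \<in> carrier_vec (m * n0)" "F x = F0" using Fsurj[OF F0] by blast
      have "\<psi> x = h"
        using h M X mult_left_inverse_cancel[OF F0 M(1) X(1) L(1,2), of F1]
          mult_left_inverse_cancel[OF F0 M(2) X(2) L(3,4), of F2]
          mult_left_inverse_cancel[OF F0 M(3) X(3) L(5,6), of F3]
          mult_left_inverse_cancel[OF F0 M(4) X(4) L(7,8), of F4]
        by (simp add: \<psi>_def hF x)
      then have "x \<in> (\<lambda>z. G *\<^sub>v z) ` carrier_vec (cor N)"
        unfolding G(3) using kerF[OF x(1)] h x(1) by simp
      then show "h \<in> ?I" using \<open>\<psi> x = h\<close> by blast
    qed
    show "\<psi> (G *\<^sub>v (v + z)) = \<psi> (G *\<^sub>v v) \<oplus>\<^bsub>hom_space (A, B, C, D) (a, b, c, d)\<^esub> \<psi> (G *\<^sub>v z)"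
      if "v \<in> carrier_vec (cor N)" "z \<in> carrier_vec (cor N)" for v z
    proof -
      have "L' * ((F x + F y) * A') = L' * (F x * A') + L' * (F y * A')"
        if "A' \<in> carrier_mat n0 l" "L' \<in> carrier_mat k m" for x y A' L' k l
        using that Fc[of x] Fc[of y] add_mult_distrib_mat[OF Fc[of x] Fc[of y] that(1)]
          mult_add_distrib_mat[OF that(2) mult_carrier_mat[OF Fc[of x] that(1)] mult_carrier_mat[OF Fc[of y] that(1)]]
        by simp
      then show ?thesis
        using that G(1) mult_add_distrib_mat_vec[OF G(1) that] Fadd[OF Gz Gz] M L by (simp add: \<psi>_def)
    qed
    show "\<psi> (G *\<^sub>v (r \<cdot>\<^sub>v v)) = r \<odot>\<^bsub>hom_space (A, B, C, D) (a, b, c, d)\<^esub> \<psi> (G *\<^sub>v v)"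
      if "v \<in> carrier_vec (cor N)" for r v
    proof -
      have "L' * ((r \<cdot>\<^sub>m F x) * A') = r \<cdot>\<^sub>m (L' * (F x * A'))"
        if "A' \<in> carrier_mat n0 l" "L' \<in> carrier_mat k m" for x A' L' k l
        using mult_smult_assoc_mat[OF Fc[of x] that(1)]
          mult_smult_distrib[OF that(2) mult_carrier_mat[OF Fc[of x] that(1)]] by simp
      then show ?thesis
        using that G(1) mult_mat_vec[OF G(1) that] Fsmult[OF Gz] M L by (simp add: \<psi>_def)
    qed
  qed
qed

section \<open>Left kernels of block matrices\<close>

lemma col_comb_uminus: "j < dim_col A \<Longrightarrow> col_comb v (- A) j = - col_comb v A j"
  by (simp add: col_comb_def sum_negf)

lemma col_comb_smult: "j < dim_col A \<Longrightarrow> col_comb v (a \<cdot>\<^sub>m A) j = a * col_comb v A j"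
  by (simp add: col_comb_def sum_distrib_left mult.left_commute)

lemma col_comb_zero: "j < nc \<Longrightarrow> col_comb v (0\<^sub>m nr nc) j = 0"
  by (simp add: col_comb_def)

lemma blk_comb_single: "dim_row A = n \<Longrightarrow> blk_comb n X A j = col_comb (X 0) A j"
  by (simp add: blk_comb_def col_comb_def)

lemma blk_comb_zero: "j < nc \<Longrightarrow> blk_comb n X (0\<^sub>m nr nc) j = 0"
  by (simp add: blk_comb_def)

lemma blk_comb_cong:
  "dim_row A = dim_row B \<Longrightarrow> (\<And>i. i < dim_row A \<Longrightarrow> A $$ (i, j) = B $$ (i, l)) \<Longrightarrow>
    blk_comb n X A j = blk_comb n X B l"
  by (simp add: blk_comb_def)

lemma dim_append_rows: "dim_row (R @\<^sub>r S) = dim_row R + dim_row S" "dim_col (R @\<^sub>r S) = dim_col R"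
  by (simp_all add: append_rows_def)

lemma dim_append_cols:
  "dim_row (append_cols R S) = dim_row R" "dim_col (append_cols R S) = dim_col R + dim_col S"
  by (simp_all add: append_cols_def)

lemma sum_lessThan_add: "(\<Sum>i<a + b. f i) = (\<Sum>i<a. f i) + (\<Sum>i<b. f (a + i))"
  for f :: "nat \<Rightarrow> 'a :: comm_monoid_add"
  by (induction b) (simp_all add: add.assoc)

text \<open>\<open>R\<close> consists of \<open>k\<close> full blocks, so the blocks of
  \<open>S\<close> are renumbered by \<open>k\<close>. Three column indices are allowed because a
  column of a corner or diagonal block has another index in the assembled matrix
  \<open>T\<close>.\<close>

lemma blk_comb_split:
  assumes R: "dim_row R = k * n" and S: "n dvd dim_row S"
    and T: "dim_row T = dim_row R + dim_row S"
    and TR: "\<And>i. i < dim_row R \<Longrightarrow> T $$ (i, j) = R $$ (i, l)"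
    and TS: "\<And>i. i < dim_row S \<Longrightarrow> T $$ (dim_row R + i, j) = S $$ (i, l')"
  shows "blk_comb n X T j = blk_comb n X R l + blk_comb n (\<lambda>P. X (P + k)) S l'"
proof (cases "n = 0")
  \<comment> \<open>For \<open>n = 0\<close> the divisibility by \<open>n\<close> forces
    \<open>S\<close> to have no rows, and all sums are empty.\<close>
  case True
  then show ?thesis using assms by (simp add: blk_comb_def)
next
  case False
  have "blk_comb n X T j = (\<Sum>i<dim_row R. X (i div n) (i mod n) * T $$ (i, j)) +
    (\<Sum>i<dim_row S. X ((dim_row R + i) div n) ((dim_row R + i) mod n) * T $$ (dim_row R + i, j))"
    unfolding blk_comb_def T by (rule sum_lessThan_add)
  moreover have "(dim_row R + i) div n = i div n + k" "(dim_row R + i) mod n = i mod n" for i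
    using False by (simp_all add: R)
  ultimately show ?thesis by (simp add: blk_comb_def TR TS)
qed

lemma blk_comb_append_rows:
  assumes "dim_row R = k * n" "n dvd dim_row S" "j < dim_col R"
  shows "blk_comb n X (R @\<^sub>r S) j = blk_comb n X R j + blk_comb n (\<lambda>P. X (P + k)) S j"
  by (rule blk_comb_split) (use assms in \<open>simp_all add: append_rows_def\<close>)

lemma blk_comb_append_row:
  assumes "dim_row R = n" "n dvd dim_row S" "j < dim_col R"
  shows "blk_comb n X (R @\<^sub>r S) j = blk_comb n X R j + blk_comb n (\<lambda>P. X (P + 1)) S j"
  by (rule blk_comb_append_rows) (use assms in simp_all)

lemma blk_comb_append_cols_left:
  assumes "j < dim_col A"
  shows "blk_comb n X (append_cols A B) j = blk_comb n X A j"
  by (rule blk_comb_cong) (use assms in \<open>simp_all add: append_cols_def\<close>)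

lemma blk_comb_diag_left:
  assumes "dim_row C = n" "dim_row D = n" "j < dim_col C"
  shows "blk_comb n X (diag_block_mat [C, D]) j = col_comb (X 0) C j"
proof -
  have "blk_comb n X (diag_block_mat [C, D]) j
      = blk_comb n X C j + blk_comb n (\<lambda>P. X (P + 1)) (0\<^sub>m n (dim_col C)) j"
    by (rule blk_comb_split) (use assms in \<open>simp_all add: Let_def\<close>)
  then show ?thesis using assms by (simp add: col_comb_zero blk_comb_single)
qed

lemma blk_comb_diag_right:
  assumes "dim_row C = n" "dim_row D = n" "dim_col C = k" "j < dim_col D"
  shows "blk_comb n X (diag_block_mat [C, D]) (k + j) = col_comb (X 1) D j"
proof -
  have "blk_comb n X (diag_block_mat [C, D]) (k + j)
      = blk_comb n X (0\<^sub>m n (dim_col D)) j + blk_comb n (\<lambda>P. X (P + 1)) D j"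
    by (rule blk_comb_split) (use assms in \<open>simp_all add: Let_def\<close>)
  then show ?thesis using assms by (simp add: col_comb_zero blk_comb_single)
qed

text \<open>\<open>E\<close> fills the last \<open>s\<close> of \<open>h\<close> blocks, whence the
  shift by h - s.\<close>

lemma blk_comb_lower_left:
  assumes "dim_row E = s * n" "nr = h * n" "s \<le> h" "dim_col E \<le> nc" "j < nc"
  shows "blk_comb n X (lower_left nr nc E) j
    = (if j < dim_col E then blk_comb n (\<lambda>P. X (P + (h - s))) E j else 0)"
proof -
  obtain u where u: "h = s + u" using assms(3) le_Suc_ex by blast
  have "blk_comb n X (lower_left nr nc E) j = blk_comb n X (0\<^sub>m ((h - s) * n) nc) j +
     blk_comb n (\<lambda>P. X (P + (h - s))) (append_cols E (0\<^sub>m (s * n) (nc - dim_col E))) j"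
    by (rule blk_comb_split)
      (use assms in \<open>simp_all add: lower_left_def append_cols_def Let_def u add_mult_distrib\<close>)
  moreover have "blk_comb n Y (append_cols E (0\<^sub>m (s * n) (nc - dim_col E))) j
      = (if j < dim_col E then blk_comb n Y E j else 0)" for Y
    using assms by (simp add: blk_comb_append_cols_left) (simp add: blk_comb_def append_cols_def)
  ultimately show ?thesis using assms by (simp add: blk_comb_zero)
qed

text \<open>\<open>E\<close> fills the first \<open>s\<close> blocks, so the block numbers stay,
  while the column index is counted from the left edge of \<open>E\<close>.\<close>

lemma blk_comb_upper_right:
  assumes "dim_row E = s * n" "nr = h * n" "s \<le> h" "dim_col E \<le> nc" "j < nc"
  shows "blk_comb n X (upper_right nr nc E) j
    = (if j < nc - dim_col E then 0 else blk_comb n X E (j - (nc - dim_col E)))"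
proof -
  obtain u where u: "h = s + u" using assms(3) le_Suc_ex by blast
  have "blk_comb n X (upper_right nr nc E) j
     = blk_comb n X (append_cols (0\<^sub>m (s * n) (nc - dim_col E)) E) j +
      blk_comb n (\<lambda>P. X (P + s)) (0\<^sub>m ((h - s) * n) nc) j"
    by (rule blk_comb_split)
      (use assms in \<open>simp_all add: upper_right_def append_cols_def Let_def u add_mult_distrib\<close>)
  moreover have "blk_comb n X (append_cols (0\<^sub>m (s * n) (nc - dim_col E)) E) j
      = (if j < nc - dim_col E then 0 else blk_comb n X E (j - (nc - dim_col E)))"
    using assms by (simp add: blk_comb_def append_cols_def)
  ultimately show ?thesis using assms by (simp add: blk_comb_zero)
qed

section \<open>Grids of blocks\<close>

lemma all_less_add_iff: "(\<forall>j<a + b. P j) \<longleftrightarrow> (\<forall>j<a. P j) \<and> (\<forall>j<b. P (a + j))" for a b :: nat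
  by (metis add_less_cancel_left le_Suc_ex not_le trans_less_add1)

lemma all_less_sum_iff:
  "(\<forall>j<(\<Sum>q<m. w q). P j) \<longleftrightarrow> (\<forall>q<m. \<forall>j<w q. P ((\<Sum>q'<q. w q') + j))" for w :: "nat \<Rightarrow> nat"
  by (induction m) (auto simp: all_less_add_iff less_Suc_eq)

text \<open>The number of blocks is a successor because \<open>hcat\<close> of the empty list is the
  0 x 0 matrix and forgets the height \<open>r\<close>. The induction peels off the leftmost block,
  hence \<open>g\<close> and \<open>w\<close> vary.\<close>

lemma hcat_entries:
  assumes "\<And>q. q < Suc m \<Longrightarrow> g q \<in> carrier_mat r (w q)"
  shows "hcat (map g [0..<Suc m]) \<in> carrier_mat r (\<Sum>q<Suc m. w q) \<and>
    (\<forall>q<Suc m. \<forall>j<w q. \<forall>i<r. hcat (map g [0..<Suc m]) $$ (i, (\<Sum>q'<q. w q') + j) = g q $$ (i, j))"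
  using assms
proof (induction m arbitrary: g w)
  case 0
  then show ?case by simp
next
  case (Suc m)
  let ?H = "hcat (map (\<lambda>q. g (Suc q)) [0..<Suc m])"
  have IH: "?H \<in> carrier_mat r (\<Sum>q<Suc m. w (Suc q))"
    "\<And>q j i. q < Suc m \<Longrightarrow> j < w (Suc q) \<Longrightarrow> i < r \<Longrightarrow>
      ?H $$ (i, (\<Sum>q'<q. w (Suc q')) + j) = g (Suc q) $$ (i, j)"
    using Suc.IH[of "\<lambda>q. g (Suc q)" "\<lambda>q. w (Suc q)", OF Suc.prems[OF Suc_mono]] by blast+
  have g0: "g 0 \<in> carrier_mat r (w 0)" using Suc.prems by simp
  \<comment> \<open>Two entries are exposed since the recursive equation of \<open>hcat\<close>
    matches only lists of length at least two.\<close>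
  have "map g [0..<Suc (Suc m)] = g 0 # g 1 # map (\<lambda>q. g (Suc (Suc q))) [0..<m]"
    by (simp add: upt_conv_Cons comp_def flip: map_Suc_upt del: upt_Suc)
  moreover have "map (\<lambda>q. g (Suc q)) [0..<Suc m] = g 1 # map (\<lambda>q. g (Suc (Suc q))) [0..<m]"
    by (simp add: upt_conv_Cons comp_def flip: map_Suc_upt del: upt_Suc)
  ultimately have eq: "hcat (map g [0..<Suc (Suc m)]) = append_cols (g 0) ?H" by simp
  have sum_eq: "(\<Sum>q'<Suc q. w q') = w 0 + (\<Sum>q'<q. w (Suc q'))" for q
    by (rule sum.lessThan_Suc_shift)
  show ?case unfolding eq
  proof (intro conjI allI impI)
    show "append_cols (g 0) ?H \<in> carrier_mat r (\<Sum>q<Suc (Suc m). w q)"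
      unfolding sum_eq using g0 IH(1) by (intro carrier_matI) (simp_all only: dim_append_cols carrier_matD)
    fix q j i assume *: "q < Suc (Suc m)" "j < w q" "i < r"
    show "append_cols (g 0) ?H $$ (i, (\<Sum>q'<q. w q') + j) = g q $$ (i, j)"
    proof (cases q)
      case 0
      then show ?thesis using * g0 IH(1) by (simp add: append_cols_def)
    next
      case (Suc q')
      have "(\<Sum>x<q'. w (Suc x)) + j < (\<Sum>x<Suc q'. w (Suc x))" using * Suc by simp
      also have "\<dots> \<le> (\<Sum>x<Suc m. w (Suc x))" using * Suc by (intro sum_mono2) auto
      finally have "(\<Sum>x<q'. w (Suc x)) + j < dim_col ?H" using IH(1) by (simp only: carrier_matD)
      then show ?thesis using * g0 IH Suc
        by (simp only: sum_eq append_cols_def) (simp add: del: upt_Suc)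
    qed
  qed
qed

text \<open>Peeling off the top block renumbers the blocks of the remainder by \<open>h 0\<close>;
  therefore the induction is over all \<open>X\<close>.\<close>

lemma vcat_blk_comb:
  assumes "\<And>p. p < Suc k \<Longrightarrow> f p \<in> carrier_mat (h p * n) w"
  shows "vcat (map f [0..<Suc k]) \<in> carrier_mat ((\<Sum>p<Suc k. h p) * n) w \<and>
    (\<forall>j<w. blk_comb n X (vcat (map f [0..<Suc k])) j
      = (\<Sum>p<Suc k. blk_comb n (\<lambda>P. X (P + (\<Sum>p'<p. h p'))) (f p) j))"
  using assms
proof (induction k arbitrary: f h X)
  case 0
  then show ?case by simp
next
  case (Suc k)
  let ?V = "vcat (map (\<lambda>q. f (Suc q)) [0..<Suc k])"
  have IH: "?V \<in> carrier_mat ((\<Sum>p<Suc k. h (Suc p)) * n) w"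
    "\<And>j Y. j < w \<Longrightarrow> blk_comb n Y ?V j
      = (\<Sum>p<Suc k. blk_comb n (\<lambda>P. Y (P + (\<Sum>p'<p. h (Suc p')))) (f (Suc p)) j)"
    using Suc.IH[of "\<lambda>p. f (Suc p)" "\<lambda>p. h (Suc p)", OF Suc.prems[OF Suc_mono]] by blast+
  have f0: "f 0 \<in> carrier_mat (h 0 * n) w" using Suc.prems by simp
  have "map f [0..<Suc (Suc k)] = f 0 # f 1 # map (\<lambda>q. f (Suc (Suc q))) [0..<k]"
    by (simp add: upt_conv_Cons comp_def flip: map_Suc_upt del: upt_Suc)
  moreover have "map (\<lambda>q. f (Suc q)) [0..<Suc k] = f 1 # map (\<lambda>q. f (Suc (Suc q))) [0..<k]"
    by (simp add: upt_conv_Cons comp_def flip: map_Suc_upt del: upt_Suc)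
  ultimately have eq: "vcat (map f [0..<Suc (Suc k)]) = f 0 @\<^sub>r ?V" by simp
  have sum_eq: "(\<Sum>p'<Suc p. h p') = h 0 + (\<Sum>p'<p. h (Suc p'))" for p
    by (rule sum.lessThan_Suc_shift)
  show ?case unfolding eq
  proof (intro conjI allI impI)
    show "f 0 @\<^sub>r ?V \<in> carrier_mat ((\<Sum>p<Suc (Suc k). h p) * n) w"
      unfolding sum_eq add_mult_distrib using f0 IH(1) by (rule carrier_append_rows)
    fix j assume j: "j < w"
    have "blk_comb n X (f 0 @\<^sub>r ?V) j = blk_comb n X (f 0) j + blk_comb n (\<lambda>P. X (P + h 0)) ?V j"
      by (rule blk_comb_append_rows) (use f0 IH(1) j in \<open>simp_all only: carrier_matD dvd_triv_right\<close>)
    also have "\<dots> = (\<Sum>p<Suc (Suc k). blk_comb n (\<lambda>P. X (P + (\<Sum>p'<p. h p'))) (f p) j)"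
      unfolding sum.lessThan_Suc_shift[of _ "Suc k"] IH(2)[OF j] sum_eq
      by (simp add: add.assoc add.commute[of "h 0"] del: sum.lessThan_Suc)
    finally show "blk_comb n X (f 0 @\<^sub>r ?V) j
      = (\<Sum>p<Suc (Suc k). blk_comb n (\<lambda>P. X (P + (\<Sum>p'<p. h p'))) (f p) j)" .
  qed
qed

text \<open>Columns are regrouped by block column, and block row p sees \<open>X\<close> from the
  total height of the block rows above it. For a bidiagonal grid at most two terms of each sum
  survive.\<close>

lemma grid_left_kernel:
  assumes G: "\<And>p q. p < Suc k \<Longrightarrow> q < Suc m \<Longrightarrow> G p q \<in> carrier_mat (h p * n) (w q)"
  defines "N \<equiv> block_mat (map (\<lambda>p. map (G p) [0..<Suc m]) [0..<Suc k])"
  shows "dim_row N = (\<Sum>p<Suc k. h p) * n"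
    and "(\<forall>j<dim_col N. blk_comb n X N j = 0) \<longleftrightarrow>
      (\<forall>q<Suc m. \<forall>j<w q. (\<Sum>p<Suc k. blk_comb n (\<lambda>P. X (P + (\<Sum>p'<p. h p'))) (G p q) j) = 0)"
proof -
  let ?W = "\<Sum>q<Suc m. w q"
  define R where "R p = hcat (map (G p) [0..<Suc m])" for p
  have R: "R p \<in> carrier_mat (h p * n) ?W"
    "\<And>q j i. q < Suc m \<Longrightarrow> j < w q \<Longrightarrow> i < h p * n \<Longrightarrow> R p $$ (i, (\<Sum>q'<q. w q') + j) = G p q $$ (i, j)"
    if "p < Suc k" for p
    using hcat_entries[of m "G p" "h p * n" w] G that unfolding R_def by blast+
  have N: "N = vcat (map R [0..<Suc k])" by (simp add: N_def block_mat_def R_def[abs_def] comp_def del: upt_Suc)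
  have V: "N \<in> carrier_mat ((\<Sum>p<Suc k. h p) * n) ?W"
    "\<And>j. j < ?W \<Longrightarrow> blk_comb n X N j = (\<Sum>p<Suc k. blk_comb n (\<lambda>P. X (P + (\<Sum>p'<p. h p'))) (R p) j)"
    using vcat_blk_comb[of k R h n ?W X] R(1) unfolding N by blast+
  show "dim_row N = (\<Sum>p<Suc k. h p) * n" using V(1) by (simp only: carrier_matD)
  have RG: "blk_comb n Y (R p) ((\<Sum>q'<q. w q') + j) = blk_comb n Y (G p q) j"
    if "p < Suc k" "q < Suc m" "j < w q" for p q j Y
    by (rule blk_comb_cong) (use that R[OF that(1)] G[OF that(1,2)] in \<open>simp_all only: carrier_matD\<close>)
  have "(\<forall>j<dim_col N. blk_comb n X N j = 0) \<longleftrightarrow>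
    (\<forall>j<?W. (\<Sum>p<Suc k. blk_comb n (\<lambda>P. X (P + (\<Sum>p'<p. h p'))) (R p) j) = 0)"
    using V by (simp only: carrier_matD cong: imp_cong)
  also have "\<dots> \<longleftrightarrow> (\<forall>q<Suc m. \<forall>j<w q.
    (\<Sum>p<Suc k. blk_comb n (\<lambda>P. X (P + (\<Sum>p'<p. h p'))) (G p q) j) = 0)"
    unfolding all_less_sum_iff
    by (intro all_cong imp_cong refl arg_cong[of _ _ "\<lambda>t. t = 0"] sum.cong) (simp_all add: RG del: sum.lessThan_Suc)
  finally show "(\<forall>j<dim_col N. blk_comb n X N j = 0) \<longleftrightarrow>
      (\<forall>q<Suc m. \<forall>j<w q. (\<Sum>p<Suc k. blk_comb n (\<lambda>P. X (P + (\<Sum>p'<p. h p'))) (G p q) j) = 0)" .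
qed

section \<open>Left kernels of the three bidiagonal matrices\<close>

lemma sum_eq_single: "(\<Sum>p<m. f p) = f q" if "q < m" "\<And>p. p < m \<Longrightarrow> p \<noteq> q \<Longrightarrow> f p = 0"
  for f :: "nat \<Rightarrow> 'a :: comm_monoid_add"
  using that sum.mono_neutral_left[of "{..<m}" "{q}" f] by auto

lemma sum_eq_pair: "(\<Sum>p<m. f p) = f q + f (Suc q)"
  if "Suc q < m" "\<And>p. p < m \<Longrightarrow> p \<noteq> q \<Longrightarrow> p \<noteq> Suc q \<Longrightarrow> f p = 0"
  for f :: "nat \<Rightarrow> 'a :: comm_monoid_add"
  using that sum.mono_neutral_left[of "{..<m}" "{q, Suc q}" f] by auto

lemma sum_first_rest: "(\<Sum>p<Suc q. if p = 0 then h' else h) = h' + q * (h :: nat)"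
  by (induction q) auto

lemma all_less_Suc_iff: "(\<forall>q<Suc i. P q) \<longleftrightarrow> P 0 \<and> (\<forall>q<i. P (Suc q))"
  using less_Suc_eq_0_disj by auto

lemma lower_left_carrier:
  "dim_row E \<le> nr \<Longrightarrow> dim_col E \<le> nc \<Longrightarrow> lower_left nr nc E \<in> carrier_mat nr nc"
  by (intro carrier_matI) (simp_all add: lower_left_def Let_def)

lemma upper_right_carrier:
  "dim_row E \<le> nr \<Longrightarrow> dim_col E \<le> nc \<Longrightarrow> upper_right nr nc E \<in> carrier_mat nr nc"
  by (intro carrier_matI) (simp_all add: upper_right_def Let_def)

text \<open>Common shape of \<open>\<M>\<^sub>2\<close>, where the grid is square, and of
  \<open>\<M>\<^sub>3\<close>, where there is one more block column than block rows.\<close>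

definition upper_bidiagonal :: "'a :: zero mat \<Rightarrow> 'a mat \<Rightarrow> 'a mat \<Rightarrow> nat \<Rightarrow> nat \<Rightarrow> 'a mat" where
  "upper_bidiagonal Z Z' E k m =
     (let ht = (\<lambda>p. if p = 0 then dim_row Z' else dim_row Z);
          wd = (\<lambda>q. if q = 0 then dim_col Z' else dim_col Z)
      in block_mat (map (\<lambda>p. map (\<lambda>q.
           if p = q then (if p = 0 then Z' else Z)
           else if q = Suc p then lower_left (ht p) (wd q) E
           else 0\<^sub>m (ht p) (wd q)) [0..<m]) [0..<k]))"

lemma M2_eq_upper_bidiagonal: "\<M>\<^sub>2 Z Z' E i = upper_bidiagonal Z Z' E (Suc i) (Suc i)"
  unfolding \<M>\<^sub>2_def upper_bidiagonal_def Suc_eq_plus1 ..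

lemma M3_eq_upper_bidiagonal: "\<M>\<^sub>3 Z Z' E i = upper_bidiagonal Z Z' E (Suc i) (Suc (Suc i))"
  unfolding \<M>\<^sub>3_def upper_bidiagonal_def by (simp only: Suc_eq_plus1 add.assoc one_add_one)

context
  fixes Z Z' E :: "'a :: field mat" and h h' s n w w' t :: nat
  assumes Z: "Z \<in> carrier_mat (h * n) w" and Z': "Z' \<in> carrier_mat (h' * n) w'"
    and E: "E \<in> carrier_mat (s * n) t"
    and le: "s \<le> h" "t \<le> w"
begin

text \<open>Heights count blocks of \<open>n\<close> rows. In block column q + 1 the copy of
  \<open>Z\<close> starts after h' + q h blocks, and \<open>E\<close> occupies the last
  \<open>s\<close> blocks before that point; \<open>s \<le> h'\<close> keeps the subtraction exact
  already for q = 0.\<close>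

lemma upper_bidiagonal_left_kernel:
  assumes h': "s \<le> h'" and m: "i \<le> m" "m \<le> Suc i"
  defines "N \<equiv> upper_bidiagonal Z Z' E (Suc i) (Suc m)"
  shows "dim_row N = (h' + i * h) * n"
    and "(\<forall>j<dim_col N. blk_comb n X N j = 0) \<longleftrightarrow>
      (\<forall>j<w'. blk_comb n X Z' j = 0) \<and>
      (\<forall>q<m. \<forall>j<w. (if q < i then blk_comb n (\<lambda>P. X (P + (h' + q * h))) Z j else 0) +
         (if j < t then blk_comb n (\<lambda>P. X (P + (h' + q * h - s))) E j else 0) = 0)"
proof -
  define ht where "ht p = (if p = 0 then dim_row Z' else dim_row Z)" for p :: nat
  define wd where "wd q = (if q = 0 then dim_col Z' else dim_col Z)" for q :: nat
  define hb where "hb p = (if p = 0 then h' else h)" for p :: nat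
  define G where "G p q = (if p = q then (if p = 0 then Z' else Z)
    else if q = Suc p then lower_left (ht p) (wd q) E else 0\<^sub>m (ht p) (wd q))" for p q
  have ht: "ht p = hb p * n" and wd: "wd q = (if q = 0 then w' else w)" for p q
    using Z Z' by (simp_all add: ht_def wd_def hb_def)
  have N: "N = block_mat (map (\<lambda>p. map (G p) [0..<Suc m]) [0..<Suc i])"
    unfolding N_def upper_bidiagonal_def Let_def G_def[abs_def] ht_def wd_def ..
  have hb: "s \<le> hb p" for p using le h' by (simp add: hb_def)
  then have st: "s * n \<le> hb p * n" for p by simp
  have Gc: "G p q \<in> carrier_mat (hb p * n) (wd q)" for p q
    using Z Z' E st[of p] le unfolding G_def ht wd
    by (auto simp: hb_def intro!: lower_left_carrier)
  have off: "(\<Sum>p<Suc q. hb p) = h' + q * h" for q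
    unfolding hb_def by (rule sum_first_rest)
  note grid = grid_left_kernel[of i m G hb n wd, OF Gc, folded N]
  show "dim_row N = (h' + i * h) * n"
    using grid(1) by (simp only: off)
  let ?b = "\<lambda>p q j. blk_comb n (\<lambda>P. X (P + (\<Sum>p'<p. hb p'))) (G p q) j"
  have first: "(\<Sum>p<Suc i. ?b p 0 j) = blk_comb n X Z' j" if "j < w'" for j
  proof -
    have "(\<Sum>p<Suc i. ?b p 0 j) = ?b 0 0 j"
      using that by (intro sum_eq_single) (auto simp: G_def wd blk_comb_zero)
    then show ?thesis by (simp add: G_def)
  qed
  have super: "?b q (Suc q) j = (if j < t then blk_comb n (\<lambda>P. X (P + (h' + q * h - s))) E j else 0)"
    if "j < w" for q j
  proof -
    have "?b q (Suc q) j = (if j < t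
      then blk_comb n (\<lambda>P. X (P + (hb q - s) + (\<Sum>p'<q. hb p'))) E j else 0)"
      using blk_comb_lower_left[of E s n "hb q * n" "hb q" w j "\<lambda>P. X (P + (\<Sum>p'<q. hb p'))"]
        E that le hb by (simp add: G_def ht wd)
    moreover have "P + (hb q - s) + (\<Sum>p'<q. hb p') = P + (h' + q * h - s)" for P
      using off[of q] hb[of q] by simp
    ultimately show ?thesis by (simp only:)
  qed
  have rest: "(\<Sum>p<Suc i. ?b p (Suc q) j) =
      (if q < i then blk_comb n (\<lambda>P. X (P + (h' + q * h))) Z j else 0) +
      (if j < t then blk_comb n (\<lambda>P. X (P + (h' + q * h - s))) E j else 0)"
    if "q < m" "j < w" for q j
  proof (cases "q < i")
    case True
    then have "(\<Sum>p<Suc i. ?b p (Suc q) j) = ?b q (Suc q) j + ?b (Suc q) (Suc q) j"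
      using that by (intro sum_eq_pair) (auto simp: G_def wd blk_comb_zero)
    moreover have "?b (Suc q) (Suc q) j = blk_comb n (\<lambda>P. X (P + (h' + q * h))) Z j"
      unfolding off by (simp add: G_def)
    ultimately show ?thesis unfolding super[OF that(2)] using True by (simp add: add.commute)
  next
    case False
    \<comment> \<open>This is the additional block column of \<open>\<M>\<^sub>3\<close>, which
      contains no diagonal block.\<close>
    then have "q = i" using that m by simp
    then have "(\<Sum>p<Suc i. ?b p (Suc q) j) = ?b q (Suc q) j"
      using that by (intro sum_eq_single) (auto simp: G_def wd blk_comb_zero)
    then show ?thesis unfolding super[OF that(2)] using False by simp
  qed
  show "(\<forall>j<dim_col N. blk_comb n X N j = 0) \<longleftrightarrow>
      (\<forall>j<w'. blk_comb n X Z' j = 0) \<and>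
      (\<forall>q<m. \<forall>j<w. (if q < i then blk_comb n (\<lambda>P. X (P + (h' + q * h))) Z j else 0) +
         (if j < t then blk_comb n (\<lambda>P. X (P + (h' + q * h - s))) E j else 0) = 0)"
    unfolding grid(2) all_less_Suc_iff[of m "\<lambda>q. \<forall>j<wd q. _ q j"]
    using first rest by (simp add: wd del: sum.lessThan_Suc)
qed

lemma M2_left_kernel:
  assumes "s \<le> h'"
  shows "dim_row (\<M>\<^sub>2 Z Z' E i) = (h' + i * h) * n"
    and "(\<forall>j<dim_col (\<M>\<^sub>2 Z Z' E i). blk_comb n X (\<M>\<^sub>2 Z Z' E i) j = 0) \<longleftrightarrow>
      (\<forall>j<w'. blk_comb n X Z' j = 0) \<and>
      (\<forall>q<i. \<forall>j<w. blk_comb n (\<lambda>P. X (P + (h' + q * h))) Z j +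
         (if j < t then blk_comb n (\<lambda>P. X (P + (h' + q * h - s))) E j else 0) = 0)"
  unfolding M2_eq_upper_bidiagonal
    upper_bidiagonal_left_kernel[OF assms order_refl le_SucI[OF order_refl]] by simp_all

lemma M3_left_kernel:
  assumes "s \<le> h'"
  shows "dim_row (\<M>\<^sub>3 Z Z' E i) = (h' + i * h) * n"
    and "(\<forall>j<dim_col (\<M>\<^sub>3 Z Z' E i). blk_comb n X (\<M>\<^sub>3 Z Z' E i) j = 0) \<longleftrightarrow>
      (\<forall>j<w'. blk_comb n X Z' j = 0) \<and>
      (\<forall>q<i. \<forall>j<w. blk_comb n (\<lambda>P. X (P + (h' + q * h))) Z j +
         (if j < t then blk_comb n (\<lambda>P. X (P + (h' + q * h - s))) E j else 0) = 0) \<and>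
      (\<forall>j<t. blk_comb n (\<lambda>P. X (P + (h' + i * h - s))) E j = 0)"
proof -
  note ker = upper_bidiagonal_left_kernel[OF assms le_SucI[OF order_refl] order_refl, of i]
  show "dim_row (\<M>\<^sub>3 Z Z' E i) = (h' + i * h) * n"
    unfolding M3_eq_upper_bidiagonal by (rule ker(1))
  \<comment> \<open>In the last block column only the first \<open>t\<close> columns, those of
    \<open>E\<close>, impose a condition.\<close>
  have "(\<forall>j<w. (if j < t then f j else 0) = 0) \<longleftrightarrow> (\<forall>j<t. f j = 0)" for f :: "nat \<Rightarrow> 'a"
    using le by auto
  then show "(\<forall>j<dim_col (\<M>\<^sub>3 Z Z' E i). blk_comb n X (\<M>\<^sub>3 Z Z' E i) j = 0) \<longleftrightarrow>
      (\<forall>j<w'. blk_comb n X Z' j = 0) \<and>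
      (\<forall>q<i. \<forall>j<w. blk_comb n (\<lambda>P. X (P + (h' + q * h))) Z j +
         (if j < t then blk_comb n (\<lambda>P. X (P + (h' + q * h - s))) E j else 0) = 0) \<and>
      (\<forall>j<t. blk_comb n (\<lambda>P. X (P + (h' + i * h - s))) E j = 0)"
    unfolding M3_eq_upper_bidiagonal ker(2) All_less_Suc by (simp add: conj_commute cong: imp_cong)
qed

text \<open>\<open>E\<close> takes the role of the upper right block F here. It occupies the first
  \<open>s\<close> blocks of the next block row, so its offset is where that row starts, and it
  meets only the last \<open>t\<close> columns. The last block column has nothing below its diagonal
  block.\<close>

lemma M1_left_kernel:
  assumes "t \<le> w'"
  shows "dim_row (\<M>\<^sub>1 Z Z' E i) = (h' + i * h) * n"
    and "(\<forall>j<dim_col (\<M>\<^sub>1 Z Z' E i). blk_comb n X (\<M>\<^sub>1 Z Z' E i) j = 0) \<longleftrightarrow>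
      (\<forall>j<w'. blk_comb n X Z' j +
         (if w' - t \<le> j \<and> 0 < i then blk_comb n (\<lambda>P. X (P + h')) E (j - (w' - t)) else 0) = 0) \<and>
      (\<forall>q<i. \<forall>j<w. blk_comb n (\<lambda>P. X (P + (h' + q * h))) Z j +
         (if w - t \<le> j \<and> Suc q < i then blk_comb n (\<lambda>P. X (P + (h' + Suc q * h))) E (j - (w - t)) else 0) = 0)"
proof -
  define ht where "ht p = (if p = 0 then h' else h)" for p :: nat
  define wd where "wd q = (if q = 0 then w' else w)" for q :: nat
  define G where "G p q = (if p = q then (if p = 0 then Z' else Z)
    else if p = Suc q then upper_right (ht p * n) (wd q) E else 0\<^sub>m (ht p * n) (wd q))" for p q
  have M: "\<M>\<^sub>1 Z Z' E i = block_mat (map (\<lambda>p. map (G p) [0..<Suc i]) [0..<Suc i])"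
    using Z Z' unfolding \<M>\<^sub>1_def Let_def G_def[abs_def] ht_def wd_def
    by (intro arg_cong[of _ _ block_mat] map_cong refl) auto
  have st: "s * n \<le> h * n" using le by simp
  have Gc: "G p q \<in> carrier_mat (ht p * n) (wd q)" for p q
    using Z Z' E st le assms
    by (auto simp: G_def ht_def wd_def intro!: upper_right_carrier)
  have off: "(\<Sum>p<Suc q. ht p) = h' + q * h" for q
    unfolding ht_def by (rule sum_first_rest)
  note grid = grid_left_kernel[of i i G ht n wd, OF Gc, folded M]
  show "dim_row (\<M>\<^sub>1 Z Z' E i) = (h' + i * h) * n"
    using grid(1) by (simp only: off)
  let ?b = "\<lambda>p q j. blk_comb n (\<lambda>P. X (P + (\<Sum>p'<p. ht p'))) (G p q) j"
  have sub: "?b (Suc q) q j = (if wd q - t \<le> j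
      then blk_comb n (\<lambda>P. X (P + (h' + q * h))) E (j - (wd q - t)) else 0)"
    if "j < wd q" for q j
    unfolding off using that E le assms
    by (simp add: G_def ht_def blk_comb_upper_right[of E s n "h * n" h] wd_def)
  have column: "(\<Sum>p<Suc i. ?b p q j) = ?b q q j + (if q < i then ?b (Suc q) q j else 0)"
    if "q < Suc i" "j < wd q" for q j
  proof (cases "q < i")
    case True
    then have "(\<Sum>p<Suc i. ?b p q j) = ?b q q j + ?b (Suc q) q j"
      using that by (intro sum_eq_pair) (auto simp: G_def blk_comb_zero)
    then show ?thesis using True by simp
  next
    case False
    then have "(\<Sum>p<Suc i. ?b p q j) = ?b q q j"
      using that by (intro sum_eq_single) (auto simp: G_def blk_comb_zero)
    then show ?thesis using False by simp
  qed
  have first: "(\<Sum>p<Suc i. ?b p 0 j) = blk_comb n X Z' j +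
      (if w' - t \<le> j \<and> 0 < i then blk_comb n (\<lambda>P. X (P + h')) E (j - (w' - t)) else 0)"
    if "j < w'" for j
  proof -
    have "j < wd 0" using that by (simp add: wd_def)
    then show ?thesis using column[of 0 j] sub[of j 0] by (simp add: G_def wd_def)
  qed
  have rest: "(\<Sum>p<Suc i. ?b p (Suc q) j) = blk_comb n (\<lambda>P. X (P + (h' + q * h))) Z j +
      (if w - t \<le> j \<and> Suc q < i
       then blk_comb n (\<lambda>P. X (P + (h' + Suc q * h))) E (j - (w - t)) else 0)"
    if "q < i" "j < w" for q j
  proof -
    have "j < wd (Suc q)" using that by (simp add: wd_def)
    moreover have "?b (Suc q) (Suc q) j = blk_comb n (\<lambda>P. X (P + (h' + q * h))) Z j"
      unfolding off by (simp add: G_def)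
    ultimately show ?thesis using column[of "Suc q" j] sub[of j "Suc q"] that
      by (simp add: wd_def del: sum.lessThan_Suc)
  qed
  show "(\<forall>j<dim_col (\<M>\<^sub>1 Z Z' E i). blk_comb n X (\<M>\<^sub>1 Z Z' E i) j = 0) \<longleftrightarrow>
      (\<forall>j<w'. blk_comb n X Z' j +
         (if w' - t \<le> j \<and> 0 < i then blk_comb n (\<lambda>P. X (P + h')) E (j - (w' - t)) else 0) = 0) \<and>
      (\<forall>q<i. \<forall>j<w. blk_comb n (\<lambda>P. X (P + (h' + q * h))) Z j +
         (if w - t \<le> j \<and> Suc q < i then blk_comb n (\<lambda>P. X (P + (h' + Suc q * h))) E (j - (w - t)) else 0) = 0)"
    unfolding grid(2) all_less_Suc_iff[of i "\<lambda>q. \<forall>j<wd q. _ q j"]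
    using first rest by (simp add: wd_def del: sum.lessThan_Suc)
qed

end

section \<open>Column spaces of the indecomposable representatives\<close>

definition unit_rows :: "'a :: comm_ring_1 mat \<Rightarrow> bool" where
  "unit_rows a \<longleftrightarrow> (\<forall>j<dim_col a. \<exists>p<dim_row a. \<forall>i<dim_col a. a $$ (p, i) = (if i = j then 1 else 0))"

text \<open>If row \<open>\<pi> j\<close> of \<open>a\<close> is the j-th unit vector, the 0-1
  matrix that selects the rows \<open>\<pi> j\<close> is a left inverse. A stack containing an
  identity or antidiagonal block has such rows.\<close>

lemma unit_rows_imp_left_invertible:
  assumes "unit_rows a"
  shows "left_invertible a"
proof -
  obtain \<pi> where \<pi>: "\<And>j. j < dim_col a \<Longrightarrow> \<pi> j < dim_row a"
    "\<And>i j. j < dim_col a \<Longrightarrow> i < dim_col a \<Longrightarrow> a $$ (\<pi> j, i) = (if i = j then 1 else 0)"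
    using assms unfolding unit_rows_def by metis
  let ?L = "mat (dim_col a) (dim_row a) (\<lambda>(j, p). if p = \<pi> j then 1 else 0)"
  have "?L * a = 1\<^sub>m (dim_col a)"
  proof (rule eq_matI)
    fix j i assume ji: "j < dim_row (1\<^sub>m (dim_col a))" "i < dim_col (1\<^sub>m (dim_col a))"
    have "(?L * a) $$ (j, i) = (\<Sum>p<dim_row a. (if p = \<pi> j then 1 else 0) * a $$ (p, i))"
      using ji \<pi>(1)[of j] by (simp add: scalar_prod_def atLeast0LessThan del: sum.delta)
    also have "\<dots> = a $$ (\<pi> j, i)"
      using ji by (subst sum_eq_single[of "\<pi> j"]) (simp_all add: \<pi>(1))
    finally show "(?L * a) $$ (j, i) = 1\<^sub>m (dim_col a) $$ (j, i)" using \<pi>(2)[of j i] ji by simp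
  qed simp_all
  then show ?thesis unfolding left_invertible_def by (intro bexI[of _ ?L]) auto
qed

lemma unit_rows_append_rows:
  assumes "dim_col S = dim_col R" "unit_rows R \<or> unit_rows S"
  shows "unit_rows (R @\<^sub>r S)"
  unfolding unit_rows_def dim_append_rows
proof (intro allI impI)
  fix j assume j: "j < dim_col R"
  from assms(2) show "\<exists>p<dim_row R + dim_row S.
    \<forall>i<dim_col R. (R @\<^sub>r S) $$ (p, i) = (if i = j then 1 else 0)"
  proof
    assume "unit_rows R"
    then obtain p where "p < dim_row R" "\<forall>i<dim_col R. R $$ (p, i) = (if i = j then 1 else 0)"
      using j unfolding unit_rows_def by blast
    then show ?thesis by (intro exI[of _ p]) (simp add: append_rows_def)
  next
    assume "unit_rows S"
    then obtain p where "p < dim_row S" "\<forall>i<dim_col R. S $$ (p, i) = (if i = j then 1 else 0)"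
      using j assms(1) unfolding unit_rows_def by metis
    then show ?thesis by (intro exI[of _ "dim_row R + p"]) (simp add: append_rows_def)
  qed
qed

lemma unit_rows_one: "unit_rows (1\<^sub>m n)"
  unfolding unit_rows_def by auto

lemma unit_rows_antidiag: "unit_rows (antidiag n)"
  unfolding unit_rows_def
proof (intro allI impI)
  fix j assume "j < dim_col (antidiag n :: 'a mat)"
  then show "\<exists>p<dim_row (antidiag n :: 'a mat). \<forall>i<dim_col (antidiag n :: 'a mat).
      antidiag n $$ (p, i) = (if i = j then 1 else (0 :: 'a))"
    by (intro exI[of _ "n - 1 - j"]) (auto simp: antidiag_def)
qed

text \<open>The relation w = a g. \<open>in_range\<close> does not split over stacked blocks,
  because the blocks must share one coefficient vector; with \<open>g\<close> explicit the splitting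
  is a conjunction.\<close>

definition acts :: "'a :: comm_ring_1 mat \<Rightarrow> (nat \<Rightarrow> 'a) \<Rightarrow> (nat \<Rightarrow> 'a) \<Rightarrow> bool" where
  "acts a g w \<longleftrightarrow> (\<forall>p<dim_row a. w p = (\<Sum>j<dim_col a. a $$ (p, j) * g j))"

lemma in_range_iff_acts: "in_range a w \<longleftrightarrow> (\<exists>g. acts a g w)"
  by (simp add: in_range_def acts_def)

lemma acts_append_rows:
  "dim_col S = dim_col R \<Longrightarrow>
    acts (R @\<^sub>r S) g w \<longleftrightarrow> acts R g w \<and> acts S g (\<lambda>p. w (dim_row R + p))"
  by (simp add: acts_def dim_append_rows all_less_add_iff) (simp add: append_rows_def)

text \<open>Covers the blocks whose row p is the unit vector of index \<open>f p\<close>: identity,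
  antidiagonal and the two identities with a zero column.\<close>

lemma acts_delta:
  assumes "\<And>p j. p < dim_row a \<Longrightarrow> j < dim_col a \<Longrightarrow> a $$ (p, j) = (if j = f p then 1 else 0)"
    and "\<And>p. p < dim_row a \<Longrightarrow> f p < dim_col a"
  shows "acts a g w \<longleftrightarrow> (\<forall>p<dim_row a. w p = g (f p))"
proof -
  have "(\<Sum>j<dim_col a. a $$ (p, j) * g j) = g (f p)" if "p < dim_row a" for p
  proof -
    have "(\<Sum>j<dim_col a. a $$ (p, j) * g j) = (\<Sum>j<dim_col a. if j = f p then g j else 0)"
      using assms(1)[OF that] by (intro sum.cong) auto
    then show ?thesis using assms(2)[OF that] by (simp add: sum.delta)
  qed
  then show ?thesis by (simp add: acts_def)
qed

lemma acts_one: "acts (1\<^sub>m n) g w \<longleftrightarrow> (\<forall>p<n. w p = g p)"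
  by (subst acts_delta[where f = id]) auto

lemma acts_zero: "acts (0\<^sub>m m n) g w \<longleftrightarrow> (\<forall>p<m. w p = 0)"
  by (simp add: acts_def)

lemma acts_antidiag: "acts (antidiag n) g w \<longleftrightarrow> (\<forall>p<n. w p = g (n - 1 - p))"
  by (subst acts_delta[where f = "\<lambda>p. n - 1 - p"]) (auto simp: antidiag_def)

lemma dim_id_zero_col: "dim_row (id_zero_col n) = n" "dim_col (id_zero_col n) = Suc n"
  by (simp_all add: id_zero_col_def append_cols_def)

lemma dim_zero_col_id: "dim_row (zero_col_id n) = n" "dim_col (zero_col_id n) = Suc n"
  by (simp_all add: zero_col_id_def append_cols_def)

lemma dim_antidiag: "dim_row (antidiag n) = n" "dim_col (antidiag n) = n"
  by (simp_all add: antidiag_def)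

lemma acts_id_zero_col: "acts (id_zero_col n) g w \<longleftrightarrow> (\<forall>p<n. w p = g p)"
  by (subst acts_delta[where f = id])
    (auto simp: dim_id_zero_col, auto simp: id_zero_col_def append_cols_def)

lemma acts_zero_col_id: "acts (zero_col_id n) g w \<longleftrightarrow> (\<forall>p<n. w p = g (Suc p))"
  by (subst acts_delta[where f = Suc])
    (auto simp: dim_zero_col_id, auto simp: zero_col_id_def append_cols_def)

lemma acts_jordan_block:
  "acts (jordan_block n \<mu>) g w \<longleftrightarrow> (\<forall>p<n. w p = \<mu> * g p + (if Suc p < n then g (Suc p) else 0))"
proof -
  have "(\<Sum>j<n. jordan_block n \<mu> $$ (p, j) * g j) = \<mu> * g p + (if Suc p < n then g (Suc p) else 0)"
    if "p < n" for p
  proof -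
    have "(\<Sum>j<n. jordan_block n \<mu> $$ (p, j) * g j)
      = (\<Sum>j<n. (if j = p then \<mu> * g p else 0) + (if j = Suc p then g (Suc p) else 0))"
      using that by (intro sum.cong) auto
    then show ?thesis using that by (simp add: sum.distrib sum.delta)
  qed
  then show ?thesis by (simp add: acts_def)
qed

text \<open>Neither block suffices alone: the upper one lacks the last unit vector, which is the
  last row of the lower one. For \<open>n = 0\<close> there are no rows at all; that is the map of
  I(0,j) at arm j.\<close>

lemma unit_rows_id_zero_zero_id:
  assumes "1 \<le> n"
  shows "unit_rows (id_zero_col n @\<^sub>r zero_col_id n)"
  unfolding unit_rows_def dim_append_rows dim_id_zero_col dim_zero_col_id
proof (intro allI impI)
  fix j assume "j < Suc n"
  then show "\<exists>p<n + n. \<forall>i<Suc n. (id_zero_col n @\<^sub>r zero_col_id n) $$ (p, i) = (if i = j then 1 else (0 :: 'a))"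
    using assms
    by (intro exI[of _ "if j < n then j else n + (n - 1)"])
      (auto simp: append_rows_def id_zero_col_def zero_col_id_def append_cols_def)
qed

lemmas acts_simps = acts_append_rows acts_one acts_zero acts_antidiag acts_id_zero_col
  acts_zero_col_id acts_jordan_block dim_append_rows dim_id_zero_col dim_zero_col_id dim_antidiag

section \<open>Equations of the column spaces\<close>

lemma in_range_one_zero: "in_range (1\<^sub>m n @\<^sub>r 0\<^sub>m k n) w \<longleftrightarrow> (\<forall>p<k. w (n + p) = 0)"
  unfolding in_range_iff_acts by (auto simp: acts_simps)

lemma in_range_zero_one: "in_range (0\<^sub>m k n @\<^sub>r 1\<^sub>m n) w \<longleftrightarrow> (\<forall>p<k. w p = 0)"
  unfolding in_range_iff_acts by (auto simp: acts_simps intro!: exI[of _ "\<lambda>p. w (k + p)"])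

lemma in_range_one_one: "in_range (1\<^sub>m n @\<^sub>r 1\<^sub>m n) w \<longleftrightarrow> (\<forall>j<n. w j = w (n + j))"
  unfolding in_range_iff_acts by (auto simp: acts_simps)

lemma in_range_zero_one_antidiag:
  "in_range (0\<^sub>m 1 n @\<^sub>r 1\<^sub>m n @\<^sub>r antidiag n) w \<longleftrightarrow> w 0 = 0 \<and> (\<forall>i<n. w (n + 1 + i) = w (n - i))"
  (is "?l \<longleftrightarrow> ?r")
proof
  show ?l if ?r
    unfolding in_range_iff_acts using that
    by (intro exI[of _ "\<lambda>j. w (1 + j)"]) (auto simp: acts_simps add_ac Suc_diff_Suc)
  show ?r if l: ?l
  proof -
    obtain g where "acts (0\<^sub>m 1 n @\<^sub>r 1\<^sub>m n @\<^sub>r antidiag n) g w"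
      using l unfolding in_range_iff_acts by blast
    then have g: "w 0 = 0" "\<And>j. j < n \<Longrightarrow> w (1 + j) = g j"
      "\<And>j. j < n \<Longrightarrow> w (n + 1 + j) = g (n - 1 - j)"
      by (simp_all add: acts_simps)
    have "w (n + 1 + i) = w (n - i)" if "i < n" for i
      using g(2)[of "n - 1 - i"] g(3)[OF that] that by (simp add: Suc_diff_Suc)
    then show ?thesis using g(1) by simp
  qed
qed

lemma in_range_one_antidiag_zero:
  "in_range (1\<^sub>m n @\<^sub>r antidiag n @\<^sub>r 0\<^sub>m 1 n) w \<longleftrightarrow>
    w (n + n) = 0 \<and> (\<forall>i<n. w (n + i) = w (n - 1 - i))"
  (is "?l \<longleftrightarrow> ?r")
proof
  show ?l if ?r
    unfolding in_range_iff_acts using that by (intro exI[of _ w]) (auto simp: acts_simps)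
  show ?r if ?l
    using that unfolding in_range_iff_acts by (auto simp: acts_simps)
qed

lemma in_range_zero_one_one_zero:
  "in_range (0\<^sub>m 1 n @\<^sub>r 1\<^sub>m n @\<^sub>r 1\<^sub>m n @\<^sub>r 0\<^sub>m 1 n) w \<longleftrightarrow>
    w 0 = 0 \<and> w (n + n + 1) = 0 \<and> (\<forall>j<n. w (1 + j) = w (n + 1 + j))"
  unfolding in_range_iff_acts
  by (auto simp: acts_simps mult_2 add_ac intro!: exI[of _ "\<lambda>j. w (1 + j)"])

lemma in_range_zero_one_one:
  "in_range (0\<^sub>m 1 n @\<^sub>r 1\<^sub>m n @\<^sub>r 1\<^sub>m n) w \<longleftrightarrow> w 0 = 0 \<and> (\<forall>j<n. w (1 + j) = w (n + 1 + j))"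
  unfolding in_range_iff_acts
  by (auto simp: acts_simps add_ac intro!: exI[of _ "\<lambda>j. w (1 + j)"])

lemma in_range_one_zero_one:
  "in_range (1\<^sub>m n @\<^sub>r 0\<^sub>m 1 n @\<^sub>r 1\<^sub>m n) w \<longleftrightarrow> w n = 0 \<and> (\<forall>j<n. w j = w (n + 1 + j))"
  unfolding in_range_iff_acts by (auto simp: acts_simps add_ac intro!: exI[of _ w])

lemma in_range_antidiag_id_zero:
  "in_range (antidiag (n + 1) @\<^sub>r id_zero_col n) w \<longleftrightarrow> (\<forall>i<n. w (n + 1 + i) = w (n - i))"
  (is "?l \<longleftrightarrow> ?r")
proof
  show ?l if ?r
    unfolding in_range_iff_acts using that
    by (intro exI[of _ "\<lambda>j. w (n - j)"]) (auto simp: acts_simps add_ac)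
  show ?r if ?l
    using that unfolding in_range_iff_acts by (auto simp: acts_simps add_ac)
qed

lemma in_range_zero_id_antidiag:
  "in_range (zero_col_id n @\<^sub>r antidiag (n + 1)) w \<longleftrightarrow> (\<forall>i<n. w (n - 1 - i) = w (n + i))"
  (is "?l \<longleftrightarrow> ?r")
proof
  show ?l if r: ?r
  proof -
    \<comment> \<open>The coefficients are read off the antidiagonal block, which fills rows n, ...,
      2n.\<close>
    define g where "g j = w (n + (n - j))" for j
    have "w j = g (Suc j)" if "j < n" for j
      using r[rule_format, of "n - 1 - j"] that by (simp add: g_def)
    then have "acts (zero_col_id n @\<^sub>r antidiag (n + 1)) g w" by (simp add: acts_simps g_def)
    then show ?thesis unfolding in_range_iff_acts by blast
  qed
  show ?r if l: ?l
  proof -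
    obtain g where "acts (zero_col_id n @\<^sub>r antidiag (n + 1)) g w"
      using l unfolding in_range_iff_acts by blast
    then have g: "\<And>j. j < n \<Longrightarrow> w j = g (Suc j)" "\<And>j. j < n + 1 \<Longrightarrow> w (n + j) = g (n - j)"
      by (simp_all add: acts_simps)
    show ?thesis using g(1)[of "n - 1 - _"] g(2) by (simp add: Suc_diff_Suc)
  qed
qed

lemma in_range_one_zero_id:
  "in_range (1\<^sub>m (n + 1) @\<^sub>r zero_col_id n) w \<longleftrightarrow> (\<forall>j<n. w (n + 1 + j) = w (j + 1))"
  unfolding in_range_iff_acts by (auto simp: acts_simps add_ac intro!: exI[of _ w])

lemma in_range_one_id_zero:
  "in_range (1\<^sub>m (n + 1) @\<^sub>r id_zero_col n) w \<longleftrightarrow> (\<forall>j<n. w (n + 1 + j) = w j)"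
  unfolding in_range_iff_acts by (auto simp: acts_simps add_ac intro!: exI[of _ w])

lemma in_range_id_zero_zero_id:
  "in_range (id_zero_col n @\<^sub>r zero_col_id n) w \<longleftrightarrow> (\<forall>j. Suc j < n \<longrightarrow> w (n + j) = w (Suc j))"
  (is "?l \<longleftrightarrow> ?r")
proof
  show ?l if ?r
  proof -
    \<comment> \<open>The upper block determines the coefficients below \<open>n\<close>; only the
      last row of the lower block reaches coefficient \<open>n\<close>.\<close>
    define g where "g j = (if j < n then w j else w (n + (j - 1)))" for j
    have "w (n + p) = g (Suc p)" if "p < n" for p
      using that \<open>?r\<close> by (simp add: g_def)
    then have "acts (id_zero_col n @\<^sub>r zero_col_id n) g w" by (simp add: acts_simps g_def)
    then show ?thesis unfolding in_range_iff_acts by blast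
  qed
  show ?r if ?l
    using that unfolding in_range_iff_acts by (auto simp: acts_simps)
qed

lemma in_range_id_zero_one:
  "in_range (id_zero_col n @\<^sub>r 1\<^sub>m (n + 1)) w \<longleftrightarrow> (\<forall>j<n. w j = w (n + j))"
  unfolding in_range_iff_acts by (auto simp: acts_simps intro!: exI[of _ "\<lambda>j. w (n + j)"])

lemma in_range_jordan_one:
  "in_range (jordan_block n \<mu> @\<^sub>r 1\<^sub>m n) w \<longleftrightarrow>
    (\<forall>j<n. w j = \<mu> * w (n + j) + (if Suc j < n then w (n + Suc j) else 0))"
  (is "?l \<longleftrightarrow> ?r")
proof
  show ?l if ?r
    unfolding in_range_iff_acts using that
    by (intro exI[of _ "\<lambda>j. w (n + j)"]) (simp add: acts_simps)
  show ?r if l: ?l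
  proof -
    obtain g where "acts (jordan_block n \<mu> @\<^sub>r 1\<^sub>m n) g w"
      using l unfolding in_range_iff_acts by blast
    then have g: "\<And>j. j < n \<Longrightarrow> w j = \<mu> * g j + (if Suc j < n then g (Suc j) else 0)"
      "\<And>j. j < n \<Longrightarrow> g j = w (n + j)"
      by (simp_all add: acts_simps)
    show ?thesis using g(1) g(2)[symmetric] by (simp del: add_Suc_right)
  qed
qed

text \<open>The single condition at \<open>n\<close> is absorbed as the case without right-hand
  side. This matches \<open>M1_left_kernel\<close>, whose last block column lacks the corner
  term.\<close>

lemma in_range_one_zero_one':
  "in_range (1\<^sub>m n @\<^sub>r 0\<^sub>m 1 n @\<^sub>r 1\<^sub>m n) w \<longleftrightarrow>
    (\<forall>j<n + 1. w j = (if j < n then w (n + 1 + j) else 0))"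
  unfolding in_range_one_zero_one by (auto simp: less_Suc_eq)

text \<open>Aligns indices where increasing block numbers correspond to decreasing row numbers of
  F_0.\<close>

lemma all_less_rev: "(\<forall>p<n. P p) \<longleftrightarrow> (\<forall>p<n. P (n - 1 - p))" for n :: nat
proof
  assume r: "\<forall>p<n. P (n - 1 - p)"
  show "\<forall>p<n. P p"
  proof (intro allI impI)
    fix p assume "p < n"
    then show "P p" using r[rule_format, of "n - 1 - p"] by simp
  qed
qed auto

lemma all_less_Suc_rev: "(\<forall>q<Suc i. P q) \<longleftrightarrow> P i \<and> (\<forall>q<i. P (i - Suc q))"
  by (subst all_less_rev) (simp add: all_less_Suc_iff)

text \<open>An injective self-map of a finite set is bijective, so no inverse of \<sigma> has to be
  exhibited.\<close>

lemma presentsI: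
  fixes A B C D a b c d N :: "'a :: field mat"
  assumes N: "dim_row N = m * n"
    and M: "dim_col A = n1" "dim_col B = n2" "dim_col C = n3" "dim_col D = n4"
    and a: "dim_row a = m" "left_invertible a" "dim_row b = m" "left_invertible b"
      "dim_row c = m" "left_invertible c" "dim_row d = m" "left_invertible d"
    and \<sigma>: "\<And>p. p < m \<Longrightarrow> \<sigma> p < m" "\<And>p q. p < m \<Longrightarrow> q < m \<Longrightarrow> \<sigma> p = \<sigma> q \<Longrightarrow> p = q"
    and ker: "\<And>X. (\<forall>j<dim_col N. blk_comb n X N j = 0) \<longleftrightarrow>
      (\<forall>j<n1. in_range a (\<lambda>p. col_comb (X (\<sigma> p)) A j)) \<and>
      (\<forall>j<n2. in_range b (\<lambda>p. col_comb (X (\<sigma> p)) B j)) \<and>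
      (\<forall>j<n3. in_range c (\<lambda>p. col_comb (X (\<sigma> p)) C j)) \<and>
      (\<forall>j<n4. in_range d (\<lambda>p. col_comb (X (\<sigma> p)) D j))"
  shows "presents n m N {(A, a), (B, b), (C, c), (D, d)}"
proof -
  have "inj_on \<sigma> {..<m}" "\<sigma> ` {..<m} \<subseteq> {..<m}" using \<sigma> by (auto simp: inj_on_def)
  then have "bij_betw \<sigma> {..<m} {..<m}" by (simp add: bij_betw_def endo_inj_surj)
  moreover have "(\<forall>j<dim_col N. blk_comb n X N j = 0) \<longleftrightarrow>
      (\<forall>(A, a) \<in> {(A, a), (B, b), (C, c), (D, d)}. \<forall>j<dim_col A. in_range a (\<lambda>p. col_comb (X (\<sigma> p)) A j))"
    for X
    unfolding ker using M by simp
  ultimately show ?thesis unfolding presents_def using N a by blast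
qed

lemma col_comb_append_cols_left:
  assumes "j < dim_col A"
  shows "col_comb v (append_cols A B) j = col_comb v A j"
  using assms by (simp add: col_comb_def append_cols_def)

lemma col_comb_append_cols_right:
  assumes "dim_row A = dim_row B" "dim_col A = k" "j < dim_col B"
  shows "col_comb v (append_cols A B) (k + j) = col_comb v B j"
  using assms by (simp add: col_comb_def append_cols_def)

lemmas blk_simps = block_mat_def col_comb_append_cols_left col_comb_append_cols_right
  blk_comb_append_row blk_comb_single col_comb_zero col_comb_uminus col_comb_smult
  blk_comb_diag_left blk_comb_diag_right dim_append_rows dim_append_cols

lemmas left_invertible_simps = unit_rows_imp_left_invertible unit_rows_append_rows
  unit_rows_one unit_rows_antidiag dim_id_zero_col dim_zero_col_id dim_antidiag

lemmas in_range_simps = in_range_one_zero in_range_zero_one in_range_one_one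
  in_range_zero_one_antidiag in_range_one_antidiag_zero in_range_zero_one_one_zero
  in_range_zero_one_one in_range_one_zero_one in_range_antidiag_id_zero
  in_range_zero_id_antidiag in_range_one_zero_id in_range_one_id_zero
  in_range_id_zero_zero_id in_range_id_zero_one in_range_jordan_one

section \<open>The block matrix of each family\<close>

text \<open>Keeps \<open>diag_block_mat [C, D]\<close> folded for \<open>blk_comb_diag_left\<close>
  and \<open>blk_comb_diag_right\<close>.\<close>

declare diag_block_mat.simps(2) [simp del]

lemma diff_eq_iff: "a - b = c \<longleftrightarrow> a = b + c" for a b c :: "'a :: ab_group_add"
  by (auto simp: algebra_simps)

text \<open>Separates the two branches of \<sigma>, which take values of opposite parity.\<close>

lemma double_neq_Suc_double: "a * 2 \<noteq> Suc (b * 2)" "Suc (b * 2) \<noteq> a * 2" for a b :: nat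
  by presburger+

lemma not_Suc_le_diff: "\<not> Suc i \<le> i - p"
  by simp

context
  fixes A B C D :: "'a :: field mat" and n0 n1 n2 n3 n4 :: nat
  assumes A: "A \<in> carrier_mat n0 n1" and B: "B \<in> carrier_mat n0 n2"
    and C: "C \<in> carrier_mat n0 n3" and D: "D \<in> carrier_mat n0 n4"
begin

lemma arm_dims: "dim_row A = n0" "dim_row B = n0" "dim_row C = n0" "dim_row D = n0"
    "dim_col A = n1" "dim_col B = n2" "dim_col C = n3" "dim_col D = n4"
  using A B C D by auto

lemma presents_postproj_zero:
  "presents n0 1 (block_mat [[A, B, C, D]])
    {(A, vcat [1\<^sub>m 0, 0\<^sub>m (0 + 1) 0]), (B, vcat [0\<^sub>m (0 + 1) 0, 1\<^sub>m 0]),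
     (C, vcat [0\<^sub>m 1 0, 1\<^sub>m 0, antidiag 0]), (D, vcat [1\<^sub>m 0, antidiag 0, 0\<^sub>m 1 0])}"
proof (rule presentsI[OF _ arm_dims(5-8), where \<sigma> = id])
  have N: "dim_row (block_mat [[A, B, C, D]]) = n0"
    "dim_col (block_mat [[A, B, C, D]]) = n1 + (n2 + (n3 + n4))"
    by (simp_all add: blk_simps arm_dims)
  fix X :: "nat \<Rightarrow> nat \<Rightarrow> 'a"
  show "(\<forall>j<dim_col (block_mat [[A, B, C, D]]). blk_comb n0 X (block_mat [[A, B, C, D]]) j = 0) \<longleftrightarrow>
    (\<forall>j<n1. in_range (vcat [1\<^sub>m 0, 0\<^sub>m (0 + 1) 0]) (\<lambda>p. col_comb (X (id p)) A j)) \<and>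
    (\<forall>j<n2. in_range (vcat [0\<^sub>m (0 + 1) 0, 1\<^sub>m 0]) (\<lambda>p. col_comb (X (id p)) B j)) \<and>
    (\<forall>j<n3. in_range (vcat [0\<^sub>m 1 0, 1\<^sub>m 0, antidiag 0]) (\<lambda>p. col_comb (X (id p)) C j)) \<and>
    (\<forall>j<n4. in_range (vcat [1\<^sub>m 0, antidiag 0, 0\<^sub>m 1 0]) (\<lambda>p. col_comb (X (id p)) D j))"
    unfolding N all_less_add_iff vcat.simps in_range_simps by (simp add: blk_simps arm_dims)
qed (auto simp: blk_simps arm_dims left_invertible_simps)

lemma presents_postproj_zero_pos:
  defines "Z' \<equiv> block_mat [[A, 0\<^sub>m n0 n1, B, 0\<^sub>m n0 n2, C, D],
                      [0\<^sub>m n0 n1, 0\<^sub>m n0 n1, 0\<^sub>m n0 n2, B, 0\<^sub>m n0 n3, - D],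
                      [0\<^sub>m n0 n1, A, 0\<^sub>m n0 n2, 0\<^sub>m n0 n2, - C, 0\<^sub>m n0 n4]]"
    and "Z \<equiv> block_mat [[0\<^sub>m n0 n3, - D, 0\<^sub>m n0 n1, B], [- C, 0\<^sub>m n0 n4, A, 0\<^sub>m n0 n2]]"
  assumes n: "n = Suc i"
  shows "presents n0 (2 * n + 1) (\<M>\<^sub>3 Z Z' (diag_block_mat [C, D]) i)
    {(A, vcat [1\<^sub>m n, 0\<^sub>m (n + 1) n]), (B, vcat [0\<^sub>m (n + 1) n, 1\<^sub>m n]),
     (C, vcat [0\<^sub>m 1 n, 1\<^sub>m n, antidiag n]), (D, vcat [1\<^sub>m n, antidiag n, 0\<^sub>m 1 n])}"
proof -
  have Z: "Z \<in> carrier_mat (2 * n0) (n3 + (n4 + (n1 + n2)))"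
    "Z' \<in> carrier_mat (3 * n0) (n1 + (n1 + (n2 + (n2 + (n3 + n4)))))"
    "diag_block_mat [C, D] \<in> carrier_mat (2 * n0) (n3 + n4)"
    by (intro carrier_matI; simp add: Z_def Z'_def blk_simps arm_dims dim_diag_block_mat)+
  have le: "n3 + n4 \<le> n3 + (n4 + (n1 + n2))" "(2 :: nat) \<le> 3" by simp_all
  note ker = M3_left_kernel[OF Z order_refl le]
  \<comment> \<open>Rows are taken outwards from the middle: n, n-1, n+1, n-2, ... In this numbering
    D ties 2i to 2i+1, and C ties 0 to 2 and 2i-1 to 2i+2 for i >= 1. The ends 2n-1 and 2n are
    annihilated by C and D: the last block column of \<open>\<M>\<^sub>3\<close>.\<close>
  define \<sigma> where "\<sigma> p = (if n \<le> p then (p - n) * 2 else (n - p) * 2 - 1)" for p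
  show ?thesis
  proof (rule presentsI[OF _ arm_dims(5-8), where \<sigma> = \<sigma>])
    show "dim_row (\<M>\<^sub>3 Z Z' (diag_block_mat [C, D]) i) = (2 * n + 1) * n0"
      by (simp add: ker(1) n algebra_simps)
    show "\<sigma> p < 2 * n + 1" if "p < 2 * n + 1" for p using that by (auto simp: \<sigma>_def)
    show "p = q" if "p < 2 * n + 1" "q < 2 * n + 1" "\<sigma> p = \<sigma> q" for p q
      using that by (simp add: \<sigma>_def split: if_splits; presburger)
  \<comment> \<open>Both sides turn into families of equations between blocks. Reversing the range
    of the B equations and splitting off index 0 make the two indexings agree.\<close>
  qed (unfold ker(2) all_less_add_iff, unfold vcat.simps trans[OF in_range_zero_one all_less_rev] in_range_simps n,
    unfold Suc_eq_plus1[symmetric] all_less_Suc_iff,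
    auto simp: Z_def Z'_def blk_simps arm_dims \<sigma>_def left_invertible_simps n
      not_Suc_le_diff numeral_eq_Suc)
qed

lemma presents_postproj_odd:
  defines "Z \<equiv> block_mat [[A, 0\<^sub>m n0 n2, C, D], [0\<^sub>m n0 n1, B, 0\<^sub>m n0 n3, - D]]"
  shows "presents n0 (2 * n + 2) (\<M>\<^sub>3 Z Z (- A) n)
    {(A, vcat [0\<^sub>m 1 n, 1\<^sub>m n, 1\<^sub>m n, 0\<^sub>m 1 n]),
     (B, vcat [1\<^sub>m (n + 1), 0\<^sub>m (n + 1) (n + 1)]),
     (C, vcat [0\<^sub>m (n + 1) (n + 1), 1\<^sub>m (n + 1)]),
     (D, vcat [1\<^sub>m (n + 1), 1\<^sub>m (n + 1)])}"
proof -
  have Z: "Z \<in> carrier_mat (2 * n0) (n1 + (n2 + (n3 + n4)))"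
    "Z \<in> carrier_mat (2 * n0) (n1 + (n2 + (n3 + n4)))"
    "- A \<in> carrier_mat (1 * n0) n1"
    by (intro carrier_matI; simp add: Z_def blk_simps arm_dims dim_diag_block_mat)+
  have le: "1 \<le> (2 :: nat)" "n1 \<le> n1 + (n2 + (n3 + n4))" "1 \<le> (2 :: nat)" by simp_all
  note ker = M3_left_kernel[OF Z le]
  \<comment> \<open>The two halves of F_0 are interleaved: D ties 2j to 2j+1, A ties 2j+1 to 2j+2
    and annihilates both ends of the chain.\<close>
  define \<sigma> where "\<sigma> p = (if p < n + 1 then p * 2 else (p - (n + 1)) * 2 + 1)" for p
  show ?thesis
  proof (rule presentsI[OF _ arm_dims(5-8), where \<sigma> = \<sigma>])
    show "dim_row (\<M>\<^sub>3 Z Z (- A) n) = (2 * n + 2) * n0"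
      by (simp add: ker(1) algebra_simps)
    show "\<sigma> p < 2 * n + 2" if "p < 2 * n + 2" for p using that by (auto simp: \<sigma>_def)
    show "p = q" if "p < 2 * n + 2" "q < 2 * n + 2" "\<sigma> p = \<sigma> q" for p q
      using that by (simp add: \<sigma>_def double_neq_Suc_double split: if_splits)
  qed (unfold ker(2) all_less_add_iff, unfold vcat.simps in_range_simps,
    unfold Suc_eq_plus1[symmetric] all_less_Suc_iff,
    auto simp: Z_def blk_simps arm_dims \<sigma>_def left_invertible_simps)
qed

lemma presents_postproj_even:
  defines "Z \<equiv> block_mat [[C, A, 0\<^sub>m n0 n2, 0\<^sub>m n0 n4], [- C, 0\<^sub>m n0 n1, B, D]]"
    and "Z' \<equiv> block_mat [[B, C, D]]"
  shows "presents n0 (2 * n + 1) (\<M>\<^sub>1 Z Z' (- D) n)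
    {(A, vcat [1\<^sub>m (n + 1), 0\<^sub>m n (n + 1)]),
     (B, vcat [0\<^sub>m (n + 1) n, 1\<^sub>m n]),
     (C, vcat [0\<^sub>m 1 n, 1\<^sub>m n, 1\<^sub>m n]),
     (D, vcat [1\<^sub>m n, 0\<^sub>m 1 n, 1\<^sub>m n])}"
proof -
  have Z: "Z \<in> carrier_mat (2 * n0) (n3 + (n1 + (n2 + n4)))"
    "Z' \<in> carrier_mat (1 * n0) (n2 + (n3 + n4))"
    "- D \<in> carrier_mat (1 * n0) n4"
    by (intro carrier_matI; simp add: Z_def Z'_def blk_simps arm_dims dim_diag_block_mat)+
  have le: "1 \<le> (2 :: nat)" "n4 \<le> n3 + (n1 + (n2 + n4))" "n4 \<le> n2 + (n3 + n4)" by simp_all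
  note ker = M1_left_kernel[OF Z le]
  \<comment> \<open>D ties 2j to 2j+1 and C ties 2j+1 to 2j+2. C annihilates the first block and D
    the last.\<close>
  define \<sigma> where "\<sigma> p = (if p < n + 1 then p * 2 else (p - (n + 1)) * 2 + 1)" for p
  show ?thesis
  proof (rule presentsI[OF _ arm_dims(5-8), where \<sigma> = \<sigma>])
    show "dim_row (\<M>\<^sub>1 Z Z' (- D) n) = (2 * n + 1) * n0"
      by (simp add: ker(1) algebra_simps)
    show "\<sigma> p < 2 * n + 1" if "p < 2 * n + 1" for p using that by (auto simp: \<sigma>_def)
    show "p = q" if "p < 2 * n + 1" "q < 2 * n + 1" "\<sigma> p = \<sigma> q" for p q
      using that by (simp add: \<sigma>_def double_neq_Suc_double split: if_splits)
  qed (unfold ker(2) all_less_add_iff, unfold vcat.simps in_range_one_zero_one' in_range_simps,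
    unfold Suc_eq_plus1[symmetric] all_less_Suc_iff,
    auto simp: Z_def Z'_def blk_simps arm_dims \<sigma>_def left_invertible_simps)
qed

lemma presents_preinj_zero_pos:
  defines "Z' \<equiv> block_mat [[D, C, 0\<^sub>m n0 n1, 0\<^sub>m n0 n2],
                      [0\<^sub>m n0 n4, - C, 0\<^sub>m n0 n1, B],
                      [- D, 0\<^sub>m n0 n3, A, 0\<^sub>m n0 n2]]"
    and "Z \<equiv> block_mat [[0\<^sub>m n0 n4, - C, 0\<^sub>m n0 n1, B], [- D, 0\<^sub>m n0 n3, A, 0\<^sub>m n0 n2]]"
  assumes n: "n = Suc i"
  shows "presents n0 (2 * n + 1) (\<M>\<^sub>2 Z Z' (diag_block_mat [D, C]) i)
    {(A, vcat [0\<^sub>m n (n + 1), 1\<^sub>m (n + 1)]),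
     (B, vcat [1\<^sub>m (n + 1), 0\<^sub>m n (n + 1)]),
     (C, vcat [antidiag (n + 1), id_zero_col n]),
     (D, vcat [zero_col_id n, antidiag (n + 1)])}"
proof -
  have Z: "Z \<in> carrier_mat (2 * n0) (n4 + (n3 + (n1 + n2)))"
    "Z' \<in> carrier_mat (3 * n0) (n4 + (n3 + (n1 + n2)))"
    "diag_block_mat [D, C] \<in> carrier_mat (2 * n0) (n4 + n3)"
    by (intro carrier_matI; simp add: Z'_def Z_def blk_simps arm_dims dim_diag_block_mat)+
  have le: "2 \<le> (2 :: nat)" "n4 + n3 \<le> n4 + (n3 + (n1 + n2))" "2 \<le> (3 :: nat)" by simp_all
  note ker = M2_left_kernel[OF Z le]
  \<comment> \<open>Again outwards from the middle, now in the order n, n+1, n-1, n+2, ...: C ties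
    2i to 2i+1, and D ties 0 to 2 and 2i-1 to 2i+2 for i >= 1.\<close>
  define \<sigma> where "\<sigma> p = (if p \<le> n then (n - p) * 2 else (p - n) * 2 - 1)" for p
  show ?thesis
  proof (rule presentsI[OF _ arm_dims(5-8), where \<sigma> = \<sigma>])
    show "dim_row (\<M>\<^sub>2 Z Z' (diag_block_mat [D, C]) i) = (2 * n + 1) * n0"
      by (simp add: ker(1) n algebra_simps)
    show "\<sigma> p < 2 * n + 1" if "p < 2 * n + 1" for p using that n by (auto simp: \<sigma>_def)
    show "p = q" if "p < 2 * n + 1" "q < 2 * n + 1" "\<sigma> p = \<sigma> q" for p q
      using that n by (simp add: \<sigma>_def split: if_splits; presburger)
  qed (unfold ker(2) all_less_add_iff, unfold vcat.simps trans[OF in_range_zero_one all_less_rev] in_range_simps n,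
    unfold Suc_eq_plus1[symmetric] all_less_Suc_iff,
    auto simp: Z'_def Z_def blk_simps arm_dims \<sigma>_def left_invertible_simps n
      numeral_eq_Suc)
qed

lemma presents_preinj_odd:
  defines "Z \<equiv> block_mat [[C, D, 0\<^sub>m n0 n1, B], [0\<^sub>m n0 n3, - D, A, 0\<^sub>m n0 n2]]"
  shows "presents n0 (2 * n + 1) (\<M>\<^sub>2 Z A (- C) n)
    {(A, vcat [0\<^sub>m (n + 1) n, 1\<^sub>m n]),
     (B, vcat [1\<^sub>m (n + 1), 0\<^sub>m n (n + 1)]),
     (C, vcat [1\<^sub>m (n + 1), zero_col_id n]),
     (D, vcat [1\<^sub>m (n + 1), id_zero_col n])}"
proof -
  have Z: "Z \<in> carrier_mat (2 * n0) (n3 + (n4 + (n1 + n2)))"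
    "A \<in> carrier_mat (1 * n0) n1"
    "- C \<in> carrier_mat (1 * n0) n3"
    by (intro carrier_matI; simp add: Z_def blk_simps arm_dims dim_diag_block_mat)+
  have le: "1 \<le> (2 :: nat)" "n3 \<le> n3 + (n4 + (n1 + n2))" "1 \<le> (1 :: nat)" by simp_all
  note ker = M2_left_kernel[OF Z le]
  \<comment> \<open>The chain starts at row n and descends through both parts: n, 2n, n-1, 2n-1,
    ..., n+1, 0. C ties 2k to 2k+1 and D ties 2k+1 to 2k+2; the even blocks are annihilated by A,
    which explains the first block A.\<close>
  define \<sigma> where "\<sigma> p = (if p \<le> n then (n - p) * 2 else (n - (p - (n + 1))) * 2 - 1)" for p
  show ?thesis
  proof (rule presentsI[OF _ arm_dims(5-8), where \<sigma> = \<sigma>])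
    show "dim_row (\<M>\<^sub>2 Z A (- C) n) = (2 * n + 1) * n0"
      by (simp add: ker(1) algebra_simps)
    show "\<sigma> p < 2 * n + 1" if "p < 2 * n + 1" for p using that by (auto simp: \<sigma>_def)
    show "p = q" if "p < 2 * n + 1" "q < 2 * n + 1" "\<sigma> p = \<sigma> q" for p q
      using that by (simp add: \<sigma>_def split: if_splits; presburger)
  \<comment> \<open>All four families of equations are reversed, since \<sigma> decreases on both
    parts.\<close>
  qed (unfold ker(2) all_less_add_iff, unfold vcat.simps trans[OF in_range_zero_one all_less_rev] trans[OF in_range_one_zero all_less_rev]
      trans[OF in_range_one_zero_id all_less_rev] trans[OF in_range_one_id_zero all_less_rev],
    unfold Suc_eq_plus1[symmetric] all_less_Suc_iff,
    auto simp: Z_def blk_simps arm_dims \<sigma>_def left_invertible_simps)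
qed

lemma presents_preinj_even:
  defines "Z' \<equiv> block_mat [[B, 0\<^sub>m n0 n3, D], [0\<^sub>m n0 n2, C, - D]]"
    and "Z \<equiv> block_mat [[A, B, 0\<^sub>m n0 n3, D], [0\<^sub>m n0 n1, 0\<^sub>m n0 n2, C, - D]]"
  assumes n: "n = Suc i"
  shows "presents n0 (2 * n) (\<M>\<^sub>2 Z Z' (- A) i)
    {(A, vcat [id_zero_col n, zero_col_id n]),
     (B, vcat [0\<^sub>m n n, 1\<^sub>m n]),
     (C, vcat [1\<^sub>m n, 0\<^sub>m n n]),
     (D, vcat [1\<^sub>m n, 1\<^sub>m n])}"
proof -
  have Z: "Z \<in> carrier_mat (2 * n0) (n1 + (n2 + (n3 + n4)))"
    "Z' \<in> carrier_mat (2 * n0) (n2 + (n3 + n4))"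
    "- A \<in> carrier_mat (1 * n0) n1"
    by (intro carrier_matI; simp add: Z'_def Z_def blk_simps arm_dims dim_diag_block_mat)+
  have le: "1 \<le> (2 :: nat)" "n1 \<le> n1 + (n2 + (n3 + n4))" "1 \<le> (2 :: nat)" by simp_all
  note ker = M2_left_kernel[OF Z le]
  \<comment> \<open>D ties 2j to 2j+1 and A ties 2j+1 to 2j+2. A puts no condition on the ends of
    the chain, so Z' has no column block for A.\<close>
  define \<sigma> where "\<sigma> p = (if p < n then p * 2 else (p - n) * 2 + 1)" for p
  show ?thesis
  proof (rule presentsI[OF _ arm_dims(5-8), where \<sigma> = \<sigma>])
    show "dim_row (\<M>\<^sub>2 Z Z' (- A) i) = (2 * n) * n0"
      by (simp add: ker(1) n algebra_simps)
    show "\<sigma> p < 2 * n" if "p < 2 * n" for p using that n by (auto simp: \<sigma>_def)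
    show "p = q" if "p < 2 * n" "q < 2 * n" "\<sigma> p = \<sigma> q" for p q
      using that n by (simp add: \<sigma>_def double_neq_Suc_double split: if_splits)
  qed (unfold ker(2) all_less_add_iff, unfold vcat.simps in_range_simps n,
    unfold Suc_eq_plus1[symmetric] all_less_Suc_iff,
    auto simp: Z'_def Z_def blk_simps arm_dims \<sigma>_def left_invertible_simps n unit_rows_id_zero_zero_id)
qed

lemma presents_regular_even:
  fixes \<mu> :: 'a
  defines "Z \<equiv> block_mat [[D, C, B, 0\<^sub>m n0 n1], [(- \<mu>) \<cdot>\<^sub>m D, - C, 0\<^sub>m n0 n2, A]]"
  assumes n: "l = Suc i"
  shows "presents n0 (2 * l) (\<M>\<^sub>2 Z Z (- D) i)
    {(A, vcat [1\<^sub>m l, 0\<^sub>m l l]),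
     (B, vcat [0\<^sub>m l l, 1\<^sub>m l]),
     (C, vcat [1\<^sub>m l, 1\<^sub>m l]),
     (D, vcat [jordan_block l \<mu>, 1\<^sub>m l])}"
proof -
  have Z: "Z \<in> carrier_mat (2 * n0) (n4 + (n3 + (n2 + n1)))"
    "Z \<in> carrier_mat (2 * n0) (n4 + (n3 + (n2 + n1)))"
    "- D \<in> carrier_mat (1 * n0) n4"
    by (intro carrier_matI; simp add: Z_def blk_simps arm_dims dim_diag_block_mat)+
  have le: "1 \<le> (2 :: nat)" "n4 \<le> n4 + (n3 + (n2 + n1))" "1 \<le> (2 :: nat)" by simp_all
  note ker = M2_left_kernel[OF Z le]
  \<comment> \<open>Row j of the Jordan block involves index j+1 as well. Descending order makes j+1
    precede j, which puts the off-diagonal term into the superdiagonal block -D; the last Jordan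
    row, without such a term, belongs to the first block column.\<close>
  define \<sigma> where "\<sigma> p = (if p < l then (l - 1 - p) * 2 else (l - 1 - (p - l)) * 2 + 1)" for p
  show ?thesis
  proof (rule presentsI[OF _ arm_dims(5-8), where \<sigma> = \<sigma>])
    show "dim_row (\<M>\<^sub>2 Z Z (- D) i) = (2 * l) * n0"
      by (simp add: ker(1) n algebra_simps)
    show "\<sigma> p < 2 * l" if "p < 2 * l" for p using that n by (auto simp: \<sigma>_def)
    show "p = q" if "p < 2 * l" "q < 2 * l" "\<sigma> p = \<sigma> q" for p q
      using that n by (simp add: \<sigma>_def double_neq_Suc_double split: if_splits)
  qed (unfold ker(2) all_less_add_iff, unfold vcat.simps in_range_simps n,
    unfold Suc_eq_plus1[symmetric] all_less_Suc_rev,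
    auto simp: Z_def blk_simps arm_dims \<sigma>_def left_invertible_simps n diff_eq_iff Suc_diff_Suc less_Suc_eq_le
      simp del: Nat.add_diff_assoc Nat.add_diff_assoc2)
qed

lemma presents_regular_odd:
  defines "Z' \<equiv> block_mat [[A, C]]"
    and "Z \<equiv> block_mat [[B, D, 0\<^sub>m n0 n3, A], [0\<^sub>m n0 n2, 0\<^sub>m n0 n4, C, - A]]"
  shows "presents n0 (2 * k + 1) (\<M>\<^sub>2 Z Z' (- B) k)
    {(A, vcat [1\<^sub>m k, 0\<^sub>m 1 k, 1\<^sub>m k]),
     (B, vcat [id_zero_col k, 1\<^sub>m (k + 1)]),
     (C, vcat [1\<^sub>m k, 0\<^sub>m (k + 1) k]),
     (D, vcat [0\<^sub>m k (k + 1), 1\<^sub>m (k + 1)])}"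
proof -
  have Z: "Z \<in> carrier_mat (2 * n0) (n2 + (n4 + (n3 + n1)))"
    "Z' \<in> carrier_mat (1 * n0) (n1 + n3)"
    "- B \<in> carrier_mat (1 * n0) n2"
    by (intro carrier_matI; simp add: Z'_def Z_def blk_simps arm_dims dim_diag_block_mat)+
  have le: "1 \<le> (2 :: nat)" "n2 \<le> n2 + (n4 + (n3 + n1))" "1 \<le> (1 :: nat)" by simp_all
  note ker = M2_left_kernel[OF Z le]
  \<comment> \<open>The chain starts at row k, annihilated by A and C as Z' says. B then ties 2j to
    2j+1, and A ties 2j+1 to 2j+2.\<close>
  define \<sigma> where "\<sigma> p = (if p < k then p * 2 + 1 else (p - k) * 2)" for p
  show ?thesis
  proof (rule presentsI[OF _ arm_dims(5-8), where \<sigma> = \<sigma>])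
    show "dim_row (\<M>\<^sub>2 Z Z' (- B) k) = (2 * k + 1) * n0"
      by (simp add: ker(1) algebra_simps)
    show "\<sigma> p < 2 * k + 1" if "p < 2 * k + 1" for p using that by (auto simp: \<sigma>_def)
    show "p = q" if "p < 2 * k + 1" "q < 2 * k + 1" "\<sigma> p = \<sigma> q" for p q
      using that by (simp add: \<sigma>_def double_neq_Suc_double split: if_splits)
  qed (unfold ker(2) all_less_add_iff, unfold vcat.simps in_range_simps,
    unfold Suc_eq_plus1[symmetric] all_less_Suc_iff,
    auto simp: Z'_def Z_def blk_simps arm_dims \<sigma>_def left_invertible_simps)
qed

end

section \<open>The dimension formulas\<close>

text \<open>All four column spaces are the whole line, so F_0 is unrestricted and the presenting
  matrix has no columns.\<close>

lemma presents_preinj_zero: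
  fixes A B C D :: "'a :: field mat"
  assumes "A \<in> carrier_mat n0 n1" "B \<in> carrier_mat n0 n2" "C \<in> carrier_mat n0 n3" "D \<in> carrier_mat n0 n4"
  shows "presents n0 1 (0\<^sub>m n0 0)
    {(A, vcat [0\<^sub>m 0 (0 + 1), 1\<^sub>m (0 + 1)]), (B, vcat [1\<^sub>m (0 + 1), 0\<^sub>m 0 (0 + 1)]),
     (C, vcat [antidiag (0 + 1), id_zero_col 0]), (D, vcat [zero_col_id 0, antidiag (0 + 1)])}"
  by (rule presentsI[OF _ refl refl refl refl, where \<sigma> = id])
    (unfold vcat.simps in_range_simps, auto simp: dim_append_rows left_invertible_simps)

text \<open>The instance \<mu> = 0, with the scalar multiple of \<open>D\<close> replaced by an
  explicit zero block.\<close>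

lemma presents_regular_even_zero:
  fixes A B C D :: "'a :: field mat"
  assumes M: "A \<in> carrier_mat n0 n1" "B \<in> carrier_mat n0 n2" "C \<in> carrier_mat n0 n3" "D \<in> carrier_mat n0 n4"
    and l: "l = Suc i"
  defines "Z \<equiv> block_mat [[D, C, B, 0\<^sub>m n0 n1], [0\<^sub>m n0 n4, - C, 0\<^sub>m n0 n2, A]]"
  shows "presents n0 (2 * l) (\<M>\<^sub>2 Z Z (- D) i)
    {(A, vcat [1\<^sub>m l, 0\<^sub>m l l]), (B, vcat [0\<^sub>m l l, 1\<^sub>m l]),
     (C, vcat [1\<^sub>m l, 1\<^sub>m l]), (D, vcat [jordan_block l 0, 1\<^sub>m l])}"
proof -
  have "(- 0) \<cdot>\<^sub>m D = 0\<^sub>m n0 n4" using M(4) by (intro eq_matI) auto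
  then show ?thesis using presents_regular_even[OF M l, of 0] unfolding Z_def by simp
qed

lemma cor_no_columns: "cor (0\<^sub>m n 0 :: 'a :: field mat) = n"
  using vec_space.rank_le_nc[of "0\<^sub>m n 0 :: 'a mat" n 0] by (simp add: cor_def)

text \<open>The separate equation for \<open>S\<close> absorbs a reordering of the arms: only the
  pairing of the matrices of M with those of X matters.\<close>

lemma hom_dim_presented:
  fixes A B C D a b c d N :: "'a :: field mat"
  assumes "presents n0 m N S" "S = {(A, a), (B, b), (C, c), (D, d)}"
    and "A \<in> carrier_mat n0 n1" "B \<in> carrier_mat n0 n2" "C \<in> carrier_mat n0 n3" "D \<in> carrier_mat n0 n4"
  shows "hom_dim (A, B, C, D) (a, b, c, d) = cor N"
  using hom_dim_eq_cor[OF assms(3-6)] assms(1,2) by simp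

text \<open>Rotating M and X together preserves the set of pairs. The formula at vertex 2, say,
  arises from \<open>presents\<close> for (B, C, D, A), whose rotation is M itself; vertices 3 and 4
  are similar.\<close>

lemma hom_dim_cyc:
  fixes A B C D a b c d N :: "'a :: field mat"
  assumes N: "presents n0 m N {(A, a), (B, b), (C, c), (D, d)}"
    and A: "A \<in> carrier_mat n0 n1" and B: "B \<in> carrier_mat n0 n2"
    and C: "C \<in> carrier_mat n0 n3" and D: "D \<in> carrier_mat n0 n4"
  shows "hom_dim (A, B, C, D) (cyc 1 a b c d) = cor N"
    and "hom_dim (D, A, B, C) (cyc 2 a b c d) = cor N"
    and "hom_dim (C, D, A, B) (cyc 3 a b c d) = cor N"
    and "hom_dim (B, C, D, A) (cyc 4 a b c d) = cor N"
  using hom_dim_presented[OF N _ A B C D] hom_dim_presented[OF N _ D A B C]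
    hom_dim_presented[OF N _ C D A B] hom_dim_presented[OF N _ B C D A]
  by (simp_all add: cyc_def insert_commute)

text \<open>The space of I(0,j) at vertex 0 is zero, so every map into k at vertex j extends by
  zeros. The hom space consists of the rows of length n_j, and the bijection is given
  directly.\<close>

lemma hom_dim_preinj_zero_vertex:
  fixes A B C D :: "'a :: field mat"
  assumes M: "A \<in> carrier_mat n0 n1" "B \<in> carrier_mat n0 n2" "C \<in> carrier_mat n0 n3" "D \<in> carrier_mat n0 n4"
  shows "hom_dim (A, B, C, D) (preinj 0 1) = n1" "hom_dim (A, B, C, D) (preinj 0 2) = n2"
    "hom_dim (A, B, C, D) (preinj 0 3) = n3" "hom_dim (A, B, C, D) (preinj 0 4) = n4"
proof -
  define r where "r = (\<lambda>v :: 'a vec. mat 1 (dim_vec v) (\<lambda>(i, j). v $ j))"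
  have r_add: "r (v + w) = r v + r w" and r_smult: "r (a \<cdot>\<^sub>v v) = a \<cdot>\<^sub>m r v"
    if "v \<in> carrier_vec n" "w \<in> carrier_vec n" for v w a n
    using that by (auto simp: r_def)
  have r_inj: "v = w" if "r v = r w" "v \<in> carrier_vec n" "w \<in> carrier_vec n" for v w n
  proof (rule eq_vecI)
    fix j assume "j < dim_vec w"
    then have "v $ j = r v $$ (0, j)" "w $ j = r w $$ (0, j)" using that(2,3) by (simp_all add: r_def)
    then show "v $ j = w $ j" using that(1) by simp
  qed (use that in simp)
  have r_surj: "r (row F 0) = F" "row F 0 \<in> carrier_vec n" if "F \<in> carrier_mat 1 n" for F n
    using that by (auto simp: r_def)
  have r_dims: "dim_row (r v) = 1" "dim_col (r v) = dim_vec v" for v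
    by (simp_all add: r_def)
  have empty: "F = 0\<^sub>m 0 n" if "F \<in> carrier_mat 0 n" for F :: "'a mat" and n
    using that by (intro eq_matI) auto
  define a :: "'a mat" where "a = 0\<^sub>m 0 1"
  define b :: "'a mat" where "b = 0\<^sub>m 0 0"
  have ab: "a \<in> carrier_mat 0 1" "b \<in> carrier_mat 0 0" by (simp_all add: a_def b_def)
  have preinj: "preinj 0 1 = (a, b, b, b)" "preinj 0 2 = (b, a, b, b)"
    "preinj 0 3 = (b, b, a, b)" "preinj 0 4 = (b, b, b, a)"
    unfolding preinj_def cyc_def a_def b_def id_zero_col_def zero_col_id_def
    by (auto simp: append_rows_def append_cols_def Let_def intro!: eq_matI)
  let ?z = "\<lambda>n. 0\<^sub>m 0 n :: 'a mat"
  show "hom_dim (A, B, C, D) (preinj 0 1) = n1" unfolding preinj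
  proof (rule hom_dim_eqI[OF M ab(1,2,2,2), of "\<lambda>v. (?z n0, r v, ?z n2, ?z n3, ?z n4)"])
    show "(\<lambda>v. (?z n0, r v, ?z n2, ?z n3, ?z n4)) ` carrier_vec n1 = carrier (hom_space (A, B, C, D) (a, b, b, b))"
    proof (intro equalityI subsetI)
      fix h assume "h \<in> carrier (hom_space (A, B, C, D) (a, b, b, b))"
      then obtain F where "h = (?z n0, F, ?z n2, ?z n3, ?z n4)" "F \<in> carrier_mat 1 n1"
        using M ab by (auto dest: empty)
      then show "h \<in> (\<lambda>v. (?z n0, r v, ?z n2, ?z n3, ?z n4)) ` carrier_vec n1"
        using r_surj[of F n1] by (intro image_eqI[of _ _ "row F 0"]) auto
    qed (use M ab in \<open>auto simp: r_dims\<close>)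
  qed (use M ab r_add r_smult r_inj in \<open>auto simp: inj_on_def\<close>)
  show "hom_dim (A, B, C, D) (preinj 0 2) = n2" unfolding preinj
  proof (rule hom_dim_eqI[OF M ab(2,1,2,2), of "\<lambda>v. (?z n0, ?z n1, r v, ?z n3, ?z n4)"])
    show "(\<lambda>v. (?z n0, ?z n1, r v, ?z n3, ?z n4)) ` carrier_vec n2 = carrier (hom_space (A, B, C, D) (b, a, b, b))"
    proof (intro equalityI subsetI)
      fix h assume "h \<in> carrier (hom_space (A, B, C, D) (b, a, b, b))"
      then obtain F where "h = (?z n0, ?z n1, F, ?z n3, ?z n4)" "F \<in> carrier_mat 1 n2"
        using M ab by (auto dest: empty)
      then show "h \<in> (\<lambda>v. (?z n0, ?z n1, r v, ?z n3, ?z n4)) ` carrier_vec n2"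
        using r_surj[of F n2] by (intro image_eqI[of _ _ "row F 0"]) auto
    qed (use M ab in \<open>auto simp: r_dims\<close>)
  qed (use M ab r_add r_smult r_inj in \<open>auto simp: inj_on_def\<close>)
  show "hom_dim (A, B, C, D) (preinj 0 3) = n3" unfolding preinj
  proof (rule hom_dim_eqI[OF M ab(2,2,1,2), of "\<lambda>v. (?z n0, ?z n1, ?z n2, r v, ?z n4)"])
    show "(\<lambda>v. (?z n0, ?z n1, ?z n2, r v, ?z n4)) ` carrier_vec n3 = carrier (hom_space (A, B, C, D) (b, b, a, b))"
    proof (intro equalityI subsetI)
      fix h assume "h \<in> carrier (hom_space (A, B, C, D) (b, b, a, b))"
      then obtain F where "h = (?z n0, ?z n1, ?z n2, F, ?z n4)" "F \<in> carrier_mat 1 n3"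
        using M ab by (auto dest: empty)
      then show "h \<in> (\<lambda>v. (?z n0, ?z n1, ?z n2, r v, ?z n4)) ` carrier_vec n3"
        using r_surj[of F n3] by (intro image_eqI[of _ _ "row F 0"]) auto
    qed (use M ab in \<open>auto simp: r_dims\<close>)
  qed (use M ab r_add r_smult r_inj in \<open>auto simp: inj_on_def\<close>)
  show "hom_dim (A, B, C, D) (preinj 0 4) = n4" unfolding preinj
  proof (rule hom_dim_eqI[OF M ab(2,2,2,1), of "\<lambda>v. (?z n0, ?z n1, ?z n2, ?z n3, r v)"])
    show "(\<lambda>v. (?z n0, ?z n1, ?z n2, ?z n3, r v)) ` carrier_vec n4 = carrier (hom_space (A, B, C, D) (b, b, b, a))"
    proof (intro equalityI subsetI)
      fix h assume "h \<in> carrier (hom_space (A, B, C, D) (b, b, b, a))"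
      then obtain F where "h = (?z n0, ?z n1, ?z n2, ?z n3, F)" "F \<in> carrier_mat 1 n4"
        using M ab by (auto dest: empty)
      then show "h \<in> (\<lambda>v. (?z n0, ?z n1, ?z n2, ?z n3, r v)) ` carrier_vec n4"
        using r_surj[of F n4] by (intro image_eqI[of _ _ "row F 0"]) auto
    qed (use M ab in \<open>auto simp: r_dims\<close>)
  qed (use M ab r_add r_smult r_inj in \<open>auto simp: inj_on_def\<close>)
qed

section \<open>Representatives in the form required by the presentations\<close>

lemma postproj_odd:
  "j \<noteq> 0 \<Longrightarrow> postproj (2 * n + 1) j = cyc j
    (vcat [0\<^sub>m 1 n, 1\<^sub>m n, 1\<^sub>m n, 0\<^sub>m 1 n]) (vcat [1\<^sub>m (n + 1), 0\<^sub>m (n + 1) (n + 1)])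
    (vcat [0\<^sub>m (n + 1) (n + 1), 1\<^sub>m (n + 1)]) (vcat [1\<^sub>m (n + 1), 1\<^sub>m (n + 1)])"
  by (simp add: postproj_def)

lemma postproj_even:
  "j \<noteq> 0 \<Longrightarrow> postproj (2 * n) j = cyc j
    (vcat [1\<^sub>m (n + 1), 0\<^sub>m n (n + 1)]) (vcat [0\<^sub>m (n + 1) n, 1\<^sub>m n])
    (vcat [0\<^sub>m 1 n, 1\<^sub>m n, 1\<^sub>m n]) (vcat [1\<^sub>m n, 0\<^sub>m 1 n, 1\<^sub>m n])"
  by (simp add: postproj_def)

lemma preinj_odd:
  "j \<noteq> 0 \<Longrightarrow> preinj (2 * n + 1) j = cyc j
    (vcat [0\<^sub>m (n + 1) n, 1\<^sub>m n]) (vcat [1\<^sub>m (n + 1), 0\<^sub>m n (n + 1)])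
    (vcat [1\<^sub>m (n + 1), zero_col_id n]) (vcat [1\<^sub>m (n + 1), id_zero_col n])"
  by (simp add: preinj_def)

lemma preinj_even:
  "j \<noteq> 0 \<Longrightarrow> preinj (2 * n) j = cyc j
    (vcat [id_zero_col n, zero_col_id n]) (vcat [0\<^sub>m n n, 1\<^sub>m n])
    (vcat [1\<^sub>m n, 0\<^sub>m n n]) (vcat [1\<^sub>m n, 1\<^sub>m n])"
  by (simp add: preinj_def)

lemma reg_exc_even:
  "reg_exc s (2 * l) pt =
    (let p = vcat [1\<^sub>m l, 0\<^sub>m l l]; q = vcat [0\<^sub>m l l, 1\<^sub>m l]; e = vcat [1\<^sub>m l, 1\<^sub>m l];
         j = vcat [jordan_block l 0, 1\<^sub>m l]
     in case pt of Pt0 \<Rightarrow> if s = 0 then (p, q, e, j) else (q, p, j, e)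
        | Pt1 \<Rightarrow> if s = 0 then (q, j, p, e) else (p, e, q, j)
        | PtInf \<Rightarrow> if s = 0 then (q, p, e, j) else (p, q, j, e))"
  unfolding reg_exc_def by (simp add: Let_def)

lemma reg_exc_odd:
  assumes "1 \<le> l" "k = l - 1"
  shows "reg_exc s (2 * l - 1) pt =
    (let f = vcat [1\<^sub>m k, 0\<^sub>m 1 k, 1\<^sub>m k]; g = vcat [id_zero_col k, 1\<^sub>m (k + 1)];
         p = vcat [1\<^sub>m k, 0\<^sub>m (k + 1) k]; q = vcat [0\<^sub>m k (k + 1), 1\<^sub>m (k + 1)]
     in case pt of Pt0 \<Rightarrow> if s = 0 then (f, g, p, q) else (g, f, q, p)
        | Pt1 \<Rightarrow> if s = 0 then (g, q, f, p) else (f, p, g, q)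
        | PtInf \<Rightarrow> if s = 0 then (g, f, p, q) else (f, g, q, p))"
proof -
  have "odd (2 * l - 1)" "(2 * l - 1 + 1) div 2 = l" "l - 1 = k" "k + 1 = l" using assms by auto
  then show ?thesis unfolding reg_exc_def by (simp only: if_False Let_def)
qed

theorem proposition1:
  fixes A B C D :: "'k :: alg_closed_field mat"
    and n0 n1 n2 n3 n4 :: nat
  assumes "A \<in> carrier_mat n0 n1"
    and "B \<in> carrier_mat n0 n2"
    and "C \<in> carrier_mat n0 n3"
    and "D \<in> carrier_mat n0 n4"
  shows "hom_dim (A, B, C, D) (postproj 0 0) = cor (block_mat [[A, B, C, D]]) \<and>
         (\<forall>n\<ge>1.
         (let Z' = block_mat [[A, 0\<^sub>m n0 n1, B, 0\<^sub>m n0 n2, C, D],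
                               [0\<^sub>m n0 n1, 0\<^sub>m n0 n1, 0\<^sub>m n0 n2, B, 0\<^sub>m n0 n3, - D],
                               [0\<^sub>m n0 n1, A, 0\<^sub>m n0 n2, 0\<^sub>m n0 n2, - C, 0\<^sub>m n0 n4]];
              Z = block_mat [[0\<^sub>m n0 n3, - D, 0\<^sub>m n0 n1, B],
                              [- C, 0\<^sub>m n0 n4, A, 0\<^sub>m n0 n2]] in
          hom_dim (A, B, C, D) (postproj n 0) = cor (\<M>\<^sub>3 Z Z' (diag_block_mat [C, D]) (n - 1)))) \<and>
         (\<forall>n.
         (let Z = block_mat [[A, 0\<^sub>m n0 n2, C, D],
                              [0\<^sub>m n0 n1, B, 0\<^sub>m n0 n3, - D]] in
          hom_dim (A, B, C, D) (postproj (2 * n + 1) 1) = cor (\<M>\<^sub>3 Z Z (- A) n))) \<and>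
         (\<forall>n.
         (let Z = block_mat [[B, 0\<^sub>m n0 n3, D, A],
                              [0\<^sub>m n0 n2, C, 0\<^sub>m n0 n4, - A]] in
          hom_dim (A, B, C, D) (postproj (2 * n + 1) 2) = cor (\<M>\<^sub>3 Z Z (- B) n))) \<and>
         (\<forall>n.
         (let Z = block_mat [[C, 0\<^sub>m n0 n4, A, B],
                              [0\<^sub>m n0 n3, D, 0\<^sub>m n0 n1, - B]] in
          hom_dim (A, B, C, D) (postproj (2 * n + 1) 3) = cor (\<M>\<^sub>3 Z Z (- C) n))) \<and>
         (\<forall>n.
         (let Z = block_mat [[D, 0\<^sub>m n0 n1, B, C],
                              [0\<^sub>m n0 n4, A, 0\<^sub>m n0 n2, - C]] in
          hom_dim (A, B, C, D) (postproj (2 * n + 1) 4) = cor (\<M>\<^sub>3 Z Z (- D) n))) \<and>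
         (\<forall>n.
         (let Z' = block_mat [[B, C, D]];
              Z = block_mat [[C, A, 0\<^sub>m n0 n2, 0\<^sub>m n0 n4],
                              [- C, 0\<^sub>m n0 n1, B, D]] in
          hom_dim (A, B, C, D) (postproj (2 * n) 1) = cor (\<M>\<^sub>1 Z Z' (- D) n))) \<and>
         (\<forall>n.
         (let Z' = block_mat [[C, D, A]];
              Z = block_mat [[D, B, 0\<^sub>m n0 n3, 0\<^sub>m n0 n1],
                              [- D, 0\<^sub>m n0 n2, C, A]] in
          hom_dim (A, B, C, D) (postproj (2 * n) 2) = cor (\<M>\<^sub>1 Z Z' (- A) n))) \<and>
         (\<forall>n.
         (let Z' = block_mat [[D, A, B]];
              Z = block_mat [[A, C, 0\<^sub>m n0 n4, 0\<^sub>m n0 n2],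
                              [- A, 0\<^sub>m n0 n3, D, B]] in
          hom_dim (A, B, C, D) (postproj (2 * n) 3) = cor (\<M>\<^sub>1 Z Z' (- B) n))) \<and>
         (\<forall>n.
         (let Z' = block_mat [[A, B, C]];
              Z = block_mat [[B, D, 0\<^sub>m n0 n1, 0\<^sub>m n0 n3],
                              [- B, 0\<^sub>m n0 n4, A, C]] in
          hom_dim (A, B, C, D) (postproj (2 * n) 4) = cor (\<M>\<^sub>1 Z Z' (- C) n))) \<and>
         hom_dim (A, B, C, D) (preinj 0 0) = n0 \<and>
         (\<forall>n\<ge>1.
         (let Z' = block_mat [[D, C, 0\<^sub>m n0 n1, 0\<^sub>m n0 n2],
                               [0\<^sub>m n0 n4, - C, 0\<^sub>m n0 n1, B],
                               [- D, 0\<^sub>m n0 n3, A, 0\<^sub>m n0 n2]];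
              Z = block_mat [[0\<^sub>m n0 n4, - C, 0\<^sub>m n0 n1, B],
                              [- D, 0\<^sub>m n0 n3, A, 0\<^sub>m n0 n2]] in
          hom_dim (A, B, C, D) (preinj n 0) = cor (\<M>\<^sub>2 Z Z' (diag_block_mat [D, C]) (n - 1)))) \<and>
         (\<forall>n.
         (let Z = block_mat [[C, D, 0\<^sub>m n0 n1, B],
                              [0\<^sub>m n0 n3, - D, A, 0\<^sub>m n0 n2]] in
          hom_dim (A, B, C, D) (preinj (2 * n + 1) 1) = cor (\<M>\<^sub>2 Z A (- C) n))) \<and>
         (\<forall>n.
         (let Z = block_mat [[D, A, 0\<^sub>m n0 n2, C],
                              [0\<^sub>m n0 n4, - A, B, 0\<^sub>m n0 n3]] in
          hom_dim (A, B, C, D) (preinj (2 * n + 1) 2) = cor (\<M>\<^sub>2 Z B (- D) n))) \<and>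
         (\<forall>n.
         (let Z = block_mat [[A, B, 0\<^sub>m n0 n3, D],
                              [0\<^sub>m n0 n1, - B, C, 0\<^sub>m n0 n4]] in
          hom_dim (A, B, C, D) (preinj (2 * n + 1) 3) = cor (\<M>\<^sub>2 Z C (- A) n))) \<and>
         (\<forall>n.
         (let Z = block_mat [[B, C, 0\<^sub>m n0 n4, A],
                              [0\<^sub>m n0 n2, - C, D, 0\<^sub>m n0 n1]] in
          hom_dim (A, B, C, D) (preinj (2 * n + 1) 4) = cor (\<M>\<^sub>2 Z D (- B) n))) \<and>
         hom_dim (A, B, C, D) (preinj 0 1) = n1 \<and>
         hom_dim (A, B, C, D) (preinj 0 2) = n2 \<and>
         hom_dim (A, B, C, D) (preinj 0 3) = n3 \<and>
         hom_dim (A, B, C, D) (preinj 0 4) = n4 \<and>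
         (\<forall>n\<ge>1.
         (let Z' = block_mat [[B, 0\<^sub>m n0 n3, D],
                               [0\<^sub>m n0 n2, C, - D]];
              Z = block_mat [[A, B, 0\<^sub>m n0 n3, D],
                              [0\<^sub>m n0 n1, 0\<^sub>m n0 n2, C, - D]] in
          hom_dim (A, B, C, D) (preinj (2 * n) 1) = cor (\<M>\<^sub>2 Z Z' (- A) (n - 1)))) \<and>
         (\<forall>n\<ge>1.
         (let Z' = block_mat [[C, 0\<^sub>m n0 n4, A],
                               [0\<^sub>m n0 n3, D, - A]];
              Z = block_mat [[B, C, 0\<^sub>m n0 n4, A],
                              [0\<^sub>m n0 n2, 0\<^sub>m n0 n3, D, - A]] in
          hom_dim (A, B, C, D) (preinj (2 * n) 2) = cor (\<M>\<^sub>2 Z Z' (- B) (n - 1)))) \<and>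
         (\<forall>n\<ge>1.
         (let Z' = block_mat [[D, 0\<^sub>m n0 n1, B],
                               [0\<^sub>m n0 n4, A, - B]];
              Z = block_mat [[C, D, 0\<^sub>m n0 n1, B],
                              [0\<^sub>m n0 n3, 0\<^sub>m n0 n4, A, - B]] in
          hom_dim (A, B, C, D) (preinj (2 * n) 3) = cor (\<M>\<^sub>2 Z Z' (- C) (n - 1)))) \<and>
         (\<forall>n\<ge>1.
         (let Z' = block_mat [[A, 0\<^sub>m n0 n2, C],
                               [0\<^sub>m n0 n1, B, - C]];
              Z = block_mat [[D, A, 0\<^sub>m n0 n2, C],
                              [0\<^sub>m n0 n4, 0\<^sub>m n0 n1, B, - C]] in
          hom_dim (A, B, C, D) (preinj (2 * n) 4) = cor (\<M>\<^sub>2 Z Z' (- D) (n - 1)))) \<and>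
         (\<forall>l\<ge>1. \<forall>\<mu>. \<mu> \<noteq> 0 \<and> \<mu> \<noteq> 1 \<longrightarrow>
         (let Z = block_mat [[D, C, B, 0\<^sub>m n0 n1],
                              [(- \<mu>) \<cdot>\<^sub>m D, - C, 0\<^sub>m n0 n2, A]] in
          hom_dim (A, B, C, D) (reg_hom l \<mu>) = cor (\<M>\<^sub>2 Z Z (- D) (l - 1)))) \<and>
         (\<forall>l\<ge>1.
         (let Z = block_mat [[D, C, B, 0\<^sub>m n0 n1],
                              [0\<^sub>m n0 n4, - C, 0\<^sub>m n0 n2, A]] in
          hom_dim (A, B, C, D) (reg_exc 0 (2 * l) Pt0) = cor (\<M>\<^sub>2 Z Z (- D) (l - 1)))) \<and>
         (\<forall>l\<ge>1.
         (let Z = block_mat [[C, D, A, 0\<^sub>m n0 n2],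
                              [0\<^sub>m n0 n3, - D, 0\<^sub>m n0 n1, B]] in
          hom_dim (A, B, C, D) (reg_exc 1 (2 * l) Pt0) = cor (\<M>\<^sub>2 Z Z (- C) (l - 1)))) \<and>
         (\<forall>l\<ge>1.
         (let Z = block_mat [[B, D, A, 0\<^sub>m n0 n3],
                              [0\<^sub>m n0 n2, - D, 0\<^sub>m n0 n1, C]] in
          hom_dim (A, B, C, D) (reg_exc 0 (2 * l) Pt1) = cor (\<M>\<^sub>2 Z Z (- B) (l - 1)))) \<and>
         (\<forall>l\<ge>1.
         (let Z = block_mat [[D, B, C, 0\<^sub>m n0 n1],
                              [0\<^sub>m n0 n4, - B, 0\<^sub>m n0 n3, A]] in
          hom_dim (A, B, C, D) (reg_exc 1 (2 * l) Pt1) = cor (\<M>\<^sub>2 Z Z (- D) (l - 1)))) \<and>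
         (\<forall>l\<ge>1.
         (let Z = block_mat [[D, C, A, 0\<^sub>m n0 n2],
                              [0\<^sub>m n0 n4, - C, 0\<^sub>m n0 n1, B]] in
          hom_dim (A, B, C, D) (reg_exc 0 (2 * l) PtInf) = cor (\<M>\<^sub>2 Z Z (- D) (l - 1)))) \<and>
         (\<forall>l\<ge>1.
         (let Z = block_mat [[C, D, B, 0\<^sub>m n0 n1],
                              [0\<^sub>m n0 n3, - D, 0\<^sub>m n0 n2, A]] in
          hom_dim (A, B, C, D) (reg_exc 1 (2 * l) PtInf) = cor (\<M>\<^sub>2 Z Z (- C) (l - 1)))) \<and>
         (\<forall>l\<ge>1.
         (let Z' = block_mat [[A, C]];
              Z = block_mat [[B, D, 0\<^sub>m n0 n3, A],
                              [0\<^sub>m n0 n2, 0\<^sub>m n0 n4, C, - A]] in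
          hom_dim (A, B, C, D) (reg_exc 0 (2 * l - 1) Pt0) = cor (\<M>\<^sub>2 Z Z' (- B) (l - 1)))) \<and>
         (\<forall>l\<ge>1.
         (let Z' = block_mat [[B, D]];
              Z = block_mat [[A, C, 0\<^sub>m n0 n4, B],
                              [0\<^sub>m n0 n1, 0\<^sub>m n0 n3, D, - B]] in
          hom_dim (A, B, C, D) (reg_exc 1 (2 * l - 1) Pt0) = cor (\<M>\<^sub>2 Z Z' (- A) (l - 1)))) \<and>
         (\<forall>l\<ge>1.
         (let Z' = block_mat [[C, D]];
              Z = block_mat [[A, B, 0\<^sub>m n0 n4, C],
                              [0\<^sub>m n0 n1, 0\<^sub>m n0 n2, D, - C]] in
          hom_dim (A, B, C, D) (reg_exc 0 (2 * l - 1) Pt1) = cor (\<M>\<^sub>2 Z Z' (- A) (l - 1)))) \<and>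
         (\<forall>l\<ge>1.
         (let Z' = block_mat [[A, B]];
              Z = block_mat [[C, D, 0\<^sub>m n0 n2, A],
                              [0\<^sub>m n0 n3, 0\<^sub>m n0 n4, B, - A]] in
          hom_dim (A, B, C, D) (reg_exc 1 (2 * l - 1) Pt1) = cor (\<M>\<^sub>2 Z Z' (- C) (l - 1)))) \<and>
         (\<forall>l\<ge>1.
         (let Z' = block_mat [[B, C]];
              Z = block_mat [[A, D, 0\<^sub>m n0 n3, B],
                              [0\<^sub>m n0 n1, 0\<^sub>m n0 n4, C, - B]] in
          hom_dim (A, B, C, D) (reg_exc 0 (2 * l - 1) PtInf) = cor (\<M>\<^sub>2 Z Z' (- A) (l - 1)))) \<and>
         (\<forall>l\<ge>1.
         (let Z' = block_mat [[A, D]];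
              Z = block_mat [[B, C, 0\<^sub>m n0 n4, A],
                              [0\<^sub>m n0 n2, 0\<^sub>m n0 n3, D, - A]] in
          hom_dim (A, B, C, D) (reg_exc 1 (2 * l - 1) PtInf) = cor (\<M>\<^sub>2 Z Z' (- B) (l - 1))))"
proof -
  note A = assms(1) and B = assms(2) and C = assms(3) and D = assms(4)
  have pos: "n = Suc (n - 1)" if "1 \<le> n" for n :: nat using that by simp
  show ?thesis unfolding Let_def
  proof (intro conjI allI impI, goal_cases)
    case 1
    show ?case
      by (simp only: postproj_def simp_thms if_True,
        rule hom_dim_presented[OF presents_postproj_zero[OF A B C D] refl A B C D])
  next
    case 2
    then show ?case
      by (simp only: postproj_def simp_thms if_True,
        rule hom_dim_presented[OF presents_postproj_zero_pos[OF A B C D pos] refl A B C D])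
  next
    case 3
    show ?case
      by (subst postproj_odd, simp,
        rule hom_dim_cyc(1)[OF presents_postproj_odd[OF A B C D] A B C D])
  next
    case 4
    show ?case
      by (subst postproj_odd, simp,
        rule hom_dim_cyc(2)[OF presents_postproj_odd[OF B C D A] B C D A])
  next
    case 5
    show ?case
      by (subst postproj_odd, simp,
        rule hom_dim_cyc(3)[OF presents_postproj_odd[OF C D A B] C D A B])
  next
    case 6
    show ?case
      by (subst postproj_odd, simp,
        rule hom_dim_cyc(4)[OF presents_postproj_odd[OF D A B C] D A B C])
  next
    case 7
    show ?case
      by (subst postproj_even, simp,
        rule hom_dim_cyc(1)[OF presents_postproj_even[OF A B C D] A B C D])
  next
    case 8
    show ?case
      by (subst postproj_even, simp,
        rule hom_dim_cyc(2)[OF presents_postproj_even[OF B C D A] B C D A])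
  next
    case 9
    show ?case
      by (subst postproj_even, simp,
        rule hom_dim_cyc(3)[OF presents_postproj_even[OF C D A B] C D A B])
  next
    case 10
    show ?case
      by (subst postproj_even, simp,
        rule hom_dim_cyc(4)[OF presents_postproj_even[OF D A B C] D A B C])
  next
    case 11
    show ?case
      by (simp only: preinj_def simp_thms if_True,
        rule hom_dim_presented[OF presents_preinj_zero[OF A B C D] refl A B C D, unfolded cor_no_columns])
  next
    case 12
    then show ?case
      by (simp only: preinj_def simp_thms if_True,
        rule hom_dim_presented[OF presents_preinj_zero_pos[OF A B C D pos] refl A B C D])
  next
    case 13
    show ?case
      by (subst preinj_odd, simp,
        rule hom_dim_cyc(1)[OF presents_preinj_odd[OF A B C D] A B C D])
  next
    case 14
    show ?case
      by (subst preinj_odd, simp,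
        rule hom_dim_cyc(2)[OF presents_preinj_odd[OF B C D A] B C D A])
  next
    case 15
    show ?case
      by (subst preinj_odd, simp,
        rule hom_dim_cyc(3)[OF presents_preinj_odd[OF C D A B] C D A B])
  next
    case 16
    show ?case
      by (subst preinj_odd, simp,
        rule hom_dim_cyc(4)[OF presents_preinj_odd[OF D A B C] D A B C])
  next
    case 17
    show ?case by (rule hom_dim_preinj_zero_vertex(1)[OF A B C D])
  next
    case 18
    show ?case by (rule hom_dim_preinj_zero_vertex(2)[OF A B C D])
  next
    case 19
    show ?case by (rule hom_dim_preinj_zero_vertex(3)[OF A B C D])
  next
    case 20
    show ?case by (rule hom_dim_preinj_zero_vertex(4)[OF A B C D])
  next
    case 21
    then show ?case
      by (subst preinj_even, simp,
        rule hom_dim_cyc(1)[OF presents_preinj_even[OF A B C D pos] A B C D])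
  next
    case 22
    then show ?case
      by (subst preinj_even, simp,
        rule hom_dim_cyc(2)[OF presents_preinj_even[OF B C D A pos] B C D A])
  next
    case 23
    then show ?case
      by (subst preinj_even, simp,
        rule hom_dim_cyc(3)[OF presents_preinj_even[OF C D A B pos] C D A B])
  next
    case 24
    then show ?case
      by (subst preinj_even, simp,
        rule hom_dim_cyc(4)[OF presents_preinj_even[OF D A B C pos] D A B C])
  next
    case 25
    show ?case
      by (simp only: reg_hom_def,
        rule hom_dim_presented[OF presents_regular_even[OF A B C D pos[OF 25(1)]] refl A B C D])
  next
    \<comment> \<open>In the even exceptional cases the matrices given to
      \<open>presents_regular_even_zero\<close> are those on the arms carrying p, q, e, j, in this
      order; \<open>auto\<close> matches the sets of pairs.\<close>
    case 26
    then show ?case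
      by (simp only: reg_exc_even Let_def exc_pt.case simp_thms if_True if_False one_neq_zero,
        rule hom_dim_presented[OF presents_regular_even_zero[OF A B C D pos] _ A B C D],
        auto)
  next
    case 27
    then show ?case
      by (simp only: reg_exc_even Let_def exc_pt.case simp_thms if_True if_False one_neq_zero,
        rule hom_dim_presented[OF presents_regular_even_zero[OF B A D C pos] _ A B C D],
        auto)
  next
    case 28
    then show ?case
      by (simp only: reg_exc_even Let_def exc_pt.case simp_thms if_True if_False one_neq_zero,
        rule hom_dim_presented[OF presents_regular_even_zero[OF C A D B pos] _ A B C D],
        auto)
  next
    case 29
    then show ?case
      by (simp only: reg_exc_even Let_def exc_pt.case simp_thms if_True if_False one_neq_zero,
        rule hom_dim_presented[OF presents_regular_even_zero[OF A C B D pos] _ A B C D],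
        auto)
  next
    case 30
    then show ?case
      by (simp only: reg_exc_even Let_def exc_pt.case simp_thms if_True if_False one_neq_zero,
        rule hom_dim_presented[OF presents_regular_even_zero[OF B A C D pos] _ A B C D],
        auto)
  next
    case 31
    then show ?case
      by (simp only: reg_exc_even Let_def exc_pt.case simp_thms if_True if_False one_neq_zero,
        rule hom_dim_presented[OF presents_regular_even_zero[OF A B D C pos] _ A B C D],
        auto)
  next
    \<comment> \<open>Likewise for odd quasi-length, with the arms carrying f, g, p, q in this
      order.\<close>
    case 32
    show ?case
      by (subst reg_exc_odd[OF 32 refl],
        simp only: Let_def exc_pt.case simp_thms if_True if_False one_neq_zero,
        rule hom_dim_presented[OF presents_regular_odd[OF A B C D] _ A B C D],
        auto)
  next
    case 33
    show ?case
      by (subst reg_exc_odd[OF 33 refl],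
        simp only: Let_def exc_pt.case simp_thms if_True if_False one_neq_zero,
        rule hom_dim_presented[OF presents_regular_odd[OF B A D C] _ A B C D],
        auto)
  next
    case 34
    show ?case
      by (subst reg_exc_odd[OF 34 refl],
        simp only: Let_def exc_pt.case simp_thms if_True if_False one_neq_zero,
        rule hom_dim_presented[OF presents_regular_odd[OF C A D B] _ A B C D],
        auto)
  next
    case 35
    show ?case
      by (subst reg_exc_odd[OF 35 refl],
        simp only: Let_def exc_pt.case simp_thms if_True if_False one_neq_zero,
        rule hom_dim_presented[OF presents_regular_odd[OF A C B D] _ A B C D],
        auto)
  next
    case 36
    show ?case
      by (subst reg_exc_odd[OF 36 refl],
        simp only: Let_def exc_pt.case simp_thms if_True if_False one_neq_zero,
        rule hom_dim_presented[OF presents_regular_odd[OF B A C D] _ A B C D],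
        auto)
  next
    case 37
    show ?case
      by (subst reg_exc_odd[OF 37 refl],
        simp only: Let_def exc_pt.case simp_thms if_True if_False one_neq_zero,
        rule hom_dim_presented[OF presents_regular_odd[OF A B D C] _ A B C D],
        auto)
  qed
qed

end
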